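(* Let $(\Omega,\mathcal{B},\mu)$ be a $\sigma$-finite measure space with $\mu(\Omega)=\infty$, let $T:\Omega\to\Omega$ be a conservative, invertible, ergodic, measure-preserving transformation, let $f:\Omega\to\mathbb{R}$ be bounded and measurable, and for $\omega\in\Omega$ let $H_\omega$ be the bounded self-adjoint operator on $\ell^2(\mathbb{Z})$ given by $(H_\omega u)_n=u_{n-1}+u_{n+1}+f(T^n\omega)u_n$. Let $\Sigma\subseteq\mathbb{R}$ be the compact set such that $\sigma(H_\omega)=\Sigma$ for $\mu$-almost every $\omega$. Let $\mathcal{F}$ be the collection of sets $F\in\mathcal{B}$ with $0<\mu(F)<\infty$, and for $F\in\mathcal{F}$ let $dk^F$ be the probability measure on $\mathbb{R}$ determined by $$\int g(E)\,dk^F(E)=\frac1{\mu(F)}\int_F\langle\delta_0,g(H_\omega)\delta_0\rangle\,d\mu(\omega)$$ for all continuous compactly supported $g$. Then $$\overline{\bigcup_{F\in\mathcal{F}}\operatorname{supp}(dk^F)}=\Sigma.$$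
   Context: A measurable transformation $T$ is: invertible if it is bijective and $T^{-1}$ is measurable; measure-preserving if $\mu(T^{-1}E)=\mu(E)$ for all $E\in\mathcal{B}$; ergodic if $T^{-1}E=E$ (with $E\in\mathcal{B}$) implies $\mu(E)=0$ or $\mu(\Omega\setminus E)=0$; conservative if there is no $W\in\mathcal{B}$ with $\mu(W)>0$ such that the sets $T^{-n}W$, $n\ge 0$, are pairwise disjoint. In this setting a compact set $\Sigma$ with $\sigma(H_\omega)=\Sigma$ for $\mu$-a.e. $\omega$ exists, and it is clearly unique. $\{\delta_n\}_{n\in\mathbb{Z}}$ is the standard basis of $\ell^2(\mathbb{Z})$, and $\operatorname{supp}$ denotes the topological support of a measure. *)

theory Defs
  imports
    "HOL-Analysis.Analysis"
    "HOL-Probability.Probability"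
    "HOL-Computational_Algebra.Polynomial"
begin

section \<open>The complex Hilbert space of square-summable functions\<close>

typedef 'a ell2 = "{u :: 'a \<Rightarrow> complex. (\<lambda>n. (norm (u n))\<^sup>2) summable_on UNIV}"
  morphisms coord Abs_ell2
proof
  show "(\<lambda>_. 0) \<in> {u :: 'a \<Rightarrow> complex. (\<lambda>n. (norm (u n))\<^sup>2) summable_on UNIV}"
    by simp
qed

setup_lifting type_definition_ell2

lemma ell2_add_closed:
  fixes u v :: "'a \<Rightarrow> complex"
  assumes "(\<lambda>n. (norm (u n))\<^sup>2) summable_on UNIV" "(\<lambda>n. (norm (v n))\<^sup>2) summable_on UNIV"
  shows "(\<lambda>n. (norm (u n + v n))\<^sup>2) summable_on UNIV"
proof (rule summable_on_comparison_test)
  show "(\<lambda>n. 2 * (norm (u n))\<^sup>2 + 2 * (norm (v n))\<^sup>2) summable_on UNIV"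
    by (intro summable_on_add summable_on_cmult_right assms)
next
  fix n
  have "(norm (u n + v n))\<^sup>2 \<le> (norm (u n) + norm (v n))\<^sup>2"
    by (intro power_mono norm_triangle_ineq) auto
  also have "\<dots> \<le> 2 * (norm (u n))\<^sup>2 + 2 * (norm (v n))\<^sup>2"
    using sum_squares_bound[of "norm (u n)" "norm (v n)"] by (simp add: power2_sum)
  finally show "(norm (u n + v n))\<^sup>2 \<le> 2 * (norm (u n))\<^sup>2 + 2 * (norm (v n))\<^sup>2" .
qed auto

lemma ell2_mult_closed:
  fixes u v :: "'a \<Rightarrow> complex"
  assumes v: "\<And>n. norm (v n) \<le> C" and u: "(\<lambda>n. (norm (u n))\<^sup>2) summable_on UNIV"
  shows "(\<lambda>n. (norm (v n * u n))\<^sup>2) summable_on UNIV"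
proof (rule summable_on_comparison_test)
  show "(\<lambda>n. C\<^sup>2 * (norm (u n))\<^sup>2) summable_on UNIV"
    by (intro summable_on_cmult_right u)
next
  fix n
  have "(norm (v n))\<^sup>2 \<le> C\<^sup>2"
    by (intro power_mono v) auto
  then show "(norm (v n * u n))\<^sup>2 \<le> C\<^sup>2 * (norm (u n))\<^sup>2"
    by (simp add: norm_mult power_mult_distrib mult_right_mono)
qed auto

lemma ell2_inner_summable:
  fixes u v :: "'a \<Rightarrow> complex"
  assumes "(\<lambda>n. (norm (u n))\<^sup>2) summable_on UNIV" "(\<lambda>n. (norm (v n))\<^sup>2) summable_on UNIV"
  shows "(\<lambda>n. inner (u n) (v n)) summable_on UNIV"
proof (rule abs_summable_summable, rule summable_on_comparison_test)
  show "(\<lambda>n. (norm (u n))\<^sup>2 + (norm (v n))\<^sup>2) summable_on UNIV"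
    by (intro summable_on_add assms)
next
  fix n
  have "norm (inner (u n) (v n)) \<le> norm (u n) * norm (v n)"
    using Cauchy_Schwarz_ineq2 by simp
  also have "\<dots> \<le> (norm (u n))\<^sup>2 + (norm (v n))\<^sup>2"
    using sum_squares_bound[of "norm (u n)" "norm (v n)"]
      mult_nonneg_nonneg[of "norm (u n)" "norm (v n)", OF norm_ge_zero norm_ge_zero]
    by (simp only: mult.assoc)
  finally show "norm (inner (u n) (v n)) \<le> (norm (u n))\<^sup>2 + (norm (v n))\<^sup>2" .
qed auto

instantiation ell2 :: (type) real_inner
begin

lift_definition zero_ell2 :: "'a ell2" is "\<lambda>_. 0"
  by simp

lift_definition plus_ell2 :: "'a ell2 \<Rightarrow> 'a ell2 \<Rightarrow> 'a ell2" is "\<lambda>u v n. u n + v n"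
  by (rule ell2_add_closed)

lift_definition uminus_ell2 :: "'a ell2 \<Rightarrow> 'a ell2" is "\<lambda>u n. - u n"
  by simp

definition minus_ell2 :: "'a ell2 \<Rightarrow> 'a ell2 \<Rightarrow> 'a ell2" where
  "minus_ell2 u v = u + (- v)"

lift_definition scaleR_ell2 :: "real \<Rightarrow> 'a ell2 \<Rightarrow> 'a ell2" is "\<lambda>r u n. r *\<^sub>R u n"
  by (simp add: power_mult_distrib summable_on_cmult_right)

(* The real part of the complex inner product cinner below. *)
lift_definition inner_ell2 :: "'a ell2 \<Rightarrow> 'a ell2 \<Rightarrow> real"
  is "\<lambda>u v. \<Sum>\<^sub>\<infinity>n. inner (u n) (v n)" .

definition norm_ell2 :: "'a ell2 \<Rightarrow> real" where
  "norm_ell2 u = sqrt (inner u u)"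

definition dist_ell2 :: "'a ell2 \<Rightarrow> 'a ell2 \<Rightarrow> real" where
  "dist_ell2 u v = norm (u - v)"

definition sgn_ell2 :: "'a ell2 \<Rightarrow> 'a ell2" where
  "sgn_ell2 u = inverse (norm u) *\<^sub>R u"

definition uniformity_ell2 :: "('a ell2 \<times> 'a ell2) filter" where
  "uniformity_ell2 = (INF e\<in>{0<..}. principal {(x, y). dist x y < e})"

definition open_ell2 :: "'a ell2 set \<Rightarrow> bool" where
  "open_ell2 U = (\<forall>x\<in>U. eventually (\<lambda>(x', y). x' = x \<longrightarrow> y \<in> U) uniformity)"

instance
proof
  fix u v w :: "'a ell2" and r s :: real
  show "u + v + w = u + (v + w)" by transfer (simp add: add.assoc)
  show "u + v = v + u" by transfer (simp add: add.commute)
  show "0 + u = u" by transfer simp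
  show "- u + u = 0" by transfer simp
  show "u - v = u + - v" by (rule minus_ell2_def)
  show "r *\<^sub>R (u + v) = r *\<^sub>R u + r *\<^sub>R v" by transfer (simp add: scaleR_add_right)
  show "(r + s) *\<^sub>R u = r *\<^sub>R u + s *\<^sub>R u" by transfer (simp add: scaleR_add_left)
  show "r *\<^sub>R s *\<^sub>R u = (r * s) *\<^sub>R u" by transfer simp
  show "1 *\<^sub>R u = u" by transfer simp
  show "dist u v = norm (u - v)" by (rule dist_ell2_def)
  show "sgn u = inverse (norm u) *\<^sub>R u" by (rule sgn_ell2_def)
  show "uniformity = (INF e\<in>{0<..}. principal {(x, y :: 'a ell2). dist x y < e})"
    by (rule uniformity_ell2_def)
  show "open U = (\<forall>x\<in>U. eventually (\<lambda>(x', y). x' = x \<longrightarrow> y \<in> U) uniformity)"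
    for U :: "'a ell2 set"
    by (rule open_ell2_def)
  show "inner u v = inner v u" by transfer (simp add: inner_commute)
  show "inner (u + v) w = inner u w + inner v w"
    by transfer (simp add: inner_add_left infsum_add ell2_inner_summable)
  show "inner (r *\<^sub>R u) v = r * inner u v"
    by transfer (simp add: infsum_cmult_right')
  show "0 \<le> inner u u"
    by transfer (simp add: infsum_nonneg)
  show "inner u u = 0 \<longleftrightarrow> u = 0"
  proof transfer
    fix u :: "'a \<Rightarrow> complex"
    assume u: "(\<lambda>n. (norm (u n))\<^sup>2) summable_on UNIV"
    show "(\<Sum>\<^sub>\<infinity>n. inner (u n) (u n)) = 0 \<longleftrightarrow> u = (\<lambda>_. 0)"
    proof
      assume z: "(\<Sum>\<^sub>\<infinity>n. inner (u n) (u n)) = 0"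
      have "inner (u n) (u n) = 0" for n
        using nonneg_infsum_le_0D[of "\<lambda>n. inner (u n) (u n)" UNIV n]
          z ell2_inner_summable[OF u u] by simp
      then show "u = (\<lambda>_. 0)" by (simp add: fun_eq_iff)
    qed simp
  qed
  show "norm u = sqrt (inner u u)" by (rule norm_ell2_def)
qed

end

lift_definition scaleC :: "complex \<Rightarrow> 'a ell2 \<Rightarrow> 'a ell2" is "\<lambda>c u n. c * u n"
  by (rule ell2_mult_closed) auto

lift_definition cinner :: "'a ell2 \<Rightarrow> 'a ell2 \<Rightarrow> complex"
  is "\<lambda>u v. \<Sum>\<^sub>\<infinity>n. cnj (u n) * v n" .

lift_definition delta :: "'a \<Rightarrow> 'a ell2" is "\<lambda>n k. if k = n then 1 else 0"
proof -
  fix n :: 'a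
  have "(\<lambda>k. (norm (if k = n then 1 else 0 :: complex))\<^sup>2) summable_on {n}"
    by simp
  then show "(\<lambda>k. (norm (if k = n then 1 else 0 :: complex))\<^sup>2) summable_on UNIV"
    by (rule summable_on_cong_neutral[THEN iffD1, rotated -1]) auto
qed


section \<open>Bounded operators\<close>

definition bounded_clinear :: "('a ell2 \<Rightarrow> 'a ell2) \<Rightarrow> bool" where
  "bounded_clinear A \<longleftrightarrow> bounded_linear A \<and> (\<forall>c u. A (scaleC c u) = scaleC c (A u))"

definition spectrum :: "('a ell2 \<Rightarrow> 'a ell2) \<Rightarrow> complex set" where
  "spectrum A = {z. \<not> (\<exists>R. bounded_clinear R \<and>
     (\<forall>u. R (A u - scaleC z u) = u) \<and> (\<forall>u. A (R u) - scaleC z (R u) = u))}"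

definition poly_op :: "complex poly \<Rightarrow> ('a ell2 \<Rightarrow> 'a ell2) \<Rightarrow> 'a ell2 \<Rightarrow> 'a ell2" where
  "poly_op p A u = (\<Sum>i\<le>degree p. scaleC (coeff p i) ((A ^^ i) u))"

(* Continuous functional calculus g(A), for a bounded self-adjoint A (so that the spectrum is real
   and compact) and g continuous on the spectrum: the operator-norm limit of p_k(A), for any
   polynomials p_k converging to g uniformly on the spectrum. *)
definition cont_calculus ::
    "(real \<Rightarrow> complex) \<Rightarrow> ('a ell2 \<Rightarrow> 'a ell2) \<Rightarrow> 'a ell2 \<Rightarrow> 'a ell2" where
  "cont_calculus g A = (THE B. bounded_clinear B \<and>
     (\<forall>p. uniform_limit {x. complex_of_real x \<in> spectrum A}
            (\<lambda>k x. poly (p k) (complex_of_real x)) g sequentially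
        \<longrightarrow> (\<lambda>k. onorm (\<lambda>u. poly_op (p k) A u - B u)) \<longlonglongrightarrow> 0))"

(* Only meaningful for bounded V, see coord_schrodinger: otherwise the sequence on the right need
   not be square-summable. *)
definition schrodinger :: "(int \<Rightarrow> real) \<Rightarrow> int ell2 \<Rightarrow> int ell2" where
  "schrodinger V u =
     Abs_ell2 (\<lambda>n. coord u (n - 1) + coord u (n + 1) + complex_of_real (V n) * coord u n)"

lemma coord_schrodinger:
  assumes "\<And>n. \<bar>V n\<bar> \<le> C"
  shows "coord (schrodinger V u) n =
    coord u (n - 1) + coord u (n + 1) + complex_of_real (V n) * coord u n"
proof -
  have u: "(\<lambda>n. (norm (coord u n))\<^sup>2) summable_on UNIV"
    using coord[of u] by simp
  have "bij_betw (\<lambda>n::int. n + k) UNIV UNIV" for k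
    by (rule bij_betw_byWitness[where f' = "\<lambda>n. n - k"]) auto
  from this[THEN summable_on_reindex_bij_betw, THEN iffD2, OF u]
  have shift: "(\<lambda>n. (norm (coord u (n + k)))\<^sup>2) summable_on UNIV" for k .
  have "(\<lambda>n. (norm (coord u (n - 1)))\<^sup>2) summable_on UNIV"
    using shift[of "- 1"] by simp
  moreover have "(\<lambda>n. (norm (complex_of_real (V n) * coord u n))\<^sup>2) summable_on UNIV"
    by (rule ell2_mult_closed[OF _ u, of _ C]) (use assms in simp)
  ultimately have "(\<lambda>n. coord u (n - 1) + coord u (n + 1) + complex_of_real (V n) * coord u n)
      \<in> {u. (\<lambda>n. (norm (u n))\<^sup>2) summable_on UNIV}"
    using shift[of 1] by (auto intro!: ell2_add_closed)
  then show ?thesis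
    by (simp add: schrodinger_def Abs_ell2_inverse)
qed


section \<open>Transformations of a measure space\<close>

definition invertible_transformation :: "'a measure \<Rightarrow> ('a \<Rightarrow> 'a) \<Rightarrow> bool" where
  "invertible_transformation M T \<longleftrightarrow> T \<in> M \<rightarrow>\<^sub>M M \<and> bij_betw T (space M) (space M) \<and>
     inv_into (space M) T \<in> M \<rightarrow>\<^sub>M M"

definition measure_preserving :: "'a measure \<Rightarrow> ('a \<Rightarrow> 'a) \<Rightarrow> bool" where
  "measure_preserving M T \<longleftrightarrow>
     (\<forall>E\<in>sets M. emeasure M (T -` E \<inter> space M) = emeasure M E)"

definition ergodic :: "'a measure \<Rightarrow> ('a \<Rightarrow> 'a) \<Rightarrow> bool" where
  "ergodic M T \<longleftrightarrow>
     (\<forall>E\<in>sets M. T -` E \<inter> space M = E \<longrightarrow> emeasure M E = 0 \<or> emeasure M (space M - E) = 0)"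

definition conservative :: "'a measure \<Rightarrow> ('a \<Rightarrow> 'a) \<Rightarrow> bool" where
  "conservative M T \<longleftrightarrow>
     \<not> (\<exists>W\<in>sets M. emeasure M W > 0 \<and> disjoint_family (\<lambda>n. (T ^^ n) -` W \<inter> space M))"

definition int_iterate :: "'a measure \<Rightarrow> ('a \<Rightarrow> 'a) \<Rightarrow> int \<Rightarrow> 'a \<Rightarrow> 'a" where
  "int_iterate M T n =
     (if 0 \<le> n then T ^^ nat n else inv_into (space M) T ^^ nat (- n))"

definition ham :: "'a measure \<Rightarrow> ('a \<Rightarrow> 'a) \<Rightarrow> ('a \<Rightarrow> real) \<Rightarrow> 'a \<Rightarrow> int ell2 \<Rightarrow> int ell2" where
  "ham M T f \<omega> = schrodinger (\<lambda>n. f (int_iterate M T n \<omega>))"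


section \<open>Local densities of states\<close>

definition topological_support :: "'a::topological_space measure \<Rightarrow> 'a set" where
  "topological_support N = {x. \<forall>U. open U \<longrightarrow> x \<in> U \<longrightarrow> emeasure N U > 0}"

definition finite_positive_sets :: "'a measure \<Rightarrow> 'a set set" where
  "finite_positive_sets M = {F\<in>sets M. 0 < emeasure M F \<and> emeasure M F < \<infinity>}"

definition is_density_of_states ::
    "'a measure \<Rightarrow> ('a \<Rightarrow> 'a) \<Rightarrow> ('a \<Rightarrow> real) \<Rightarrow> 'a set \<Rightarrow> real measure \<Rightarrow> bool" where
  "is_density_of_states M T f F N \<longleftrightarrow> prob_space N \<and> sets N = sets borel \<and>
     (\<forall>g :: real \<Rightarrow> complex. continuous_on UNIV g \<and> compact (closure {E. g E \<noteq> 0}) \<longrightarrow>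
        (LINT E|N. g E) =
          (1 / measure M F) *\<^sub>R
            (LINT \<omega>:F|M. cinner (delta 0) (cont_calculus g (ham M T f \<omega>) (delta 0))))"

end

theory Submission
  imports Defs "HOL-Computational_Algebra.Fundamental_Theorem_Algebra"
begin

text \<open>
  Let \<open>h\<close> be a bump function of height \<open>1\<close> at \<open>E\<close> supported in the \<open>e\<close>-ball around \<open>E\<close>, and put \<open>g = h\<^sup>2\<close>.
  Then \<open>\<langle>\<delta>\<^sub>0, g(H\<^sub>\<omega>) \<delta>\<^sub>0\<rangle> = \<parallel>h(H\<^sub>\<omega>) \<delta>\<^sub>0\<parallel>\<^sup>2\<close> is nonnegative, so the ball is a null set of every \<open>dk\<^sup>F\<close> if
  and only if \<open>h(H\<^sub>\<omega>) \<delta>\<^sub>0 = 0\<close> almost everywhere. If \<open>g\<close> vanishes on the spectrum, this is clear.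
  Conversely, if it holds then \<open>h(H\<^sub>\<omega>) \<delta>\<^sub>n\<close> is a translate of \<open>h(H\<^bsub>T\<^sup>n \<omega>\<^esub>) \<delta>\<^sub>0 = 0\<close> for all \<open>n\<close> and almost
  every \<open>\<omega>\<close>, hence \<open>h(H\<^sub>\<omega>) = 0\<close>, and \<open>E\<close> is not in the spectrum because \<open>h(E) = 1\<close>.
\<close>

section \<open>The Hilbert space of square-summable functions\<close>

lemma summable_coord: "(\<lambda>n. (norm (coord u n))\<^sup>2) summable_on UNIV"
  using coord[of u] by simp

lemma coord_add [simp]: "coord (u + v) n = coord u n + coord v n"
  by transfer simp

lemma coord_uminus [simp]: "coord (- u) n = - coord u n"
  by transfer simp

lemma coord_diff [simp]: "coord (u - v) n = coord u n - coord v n"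
  unfolding minus_ell2_def by (simp only: coord_add coord_uminus diff_conv_add_uminus)

lemma coord_zero [simp]: "coord 0 n = 0"
  by transfer simp

lemma coord_scaleR [simp]: "coord (r *\<^sub>R u) n = r *\<^sub>R coord u n"
  by transfer simp

lemma coord_scaleC [simp]: "coord (scaleC c u) n = c * coord u n"
  by transfer simp

lemma coord_delta: "coord (delta n) k = (if k = n then 1 else 0)"
  by transfer simp

lemma ell2_eqI: "(\<And>n. coord u n = coord v n) \<Longrightarrow> u = v"
  by (metis coord_inject ext)

lemma inner_ell2_eq: "inner u v = (\<Sum>\<^sub>\<infinity>n. inner (coord u n) (coord v n))"
  by transfer simp

lemma norm_ell2_square: "(norm (u :: 'a ell2))\<^sup>2 = (\<Sum>\<^sub>\<infinity>n. (norm (coord u n))\<^sup>2)"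
  unfolding power2_norm_eq_inner inner_ell2_eq ..

lemma sum_coord_le:
  assumes "finite F"
  shows "(\<Sum>n\<in>F. (norm (coord u n))\<^sup>2) \<le> (norm u)\<^sup>2"
  unfolding norm_ell2_square
  by (rule finite_sum_le_infsum[OF summable_coord assms]) auto

lemma norm_coord_le: "norm (coord u n) \<le> norm u"
proof (rule power2_le_imp_le)
  show "(norm (coord u n))\<^sup>2 \<le> (norm u)\<^sup>2"
    using sum_coord_le[of "{n}" u] by simp
qed simp

lemma inner_delta_left: "inner (delta n) u = Re (coord u n)"
proof -
  have "inner (delta n) u = (\<Sum>\<^sub>\<infinity>k\<in>{n}. inner (coord (delta n) k) (coord u k))"
    unfolding inner_ell2_eq by (rule infsum_cong_neutral) (auto simp: coord_delta)
  then show ?thesis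
    by (simp add: coord_delta inner_complex_def)
qed

lemma cinner_delta_left: "cinner (delta n) u = coord u n"
proof -
  have "cinner (delta n) u = (\<Sum>\<^sub>\<infinity>k\<in>{n}. cnj (coord (delta n) k) * coord u k)"
    unfolding cinner.rep_eq by (rule infsum_cong_neutral) (auto simp: coord_delta)
  then show ?thesis
    by (simp add: coord_delta)
qed

text \<open>\<open>inner\<close> is only the real part of \<open>cinner\<close>. Conjugating a
  scalar that moves across it is how the complex structure enters arguments based on
  \<open>inner\<close>.\<close>

lemma inner_scaleC_left: "inner (scaleC c u) v = inner u (scaleC (cnj c) v)"
  unfolding inner_ell2_eq
  by (rule infsum_cong) (simp add: inner_complex_def algebra_simps)

lemma scaleC_one [simp]: "scaleC 1 u = u"
  and scaleC_zero_left [simp]: "scaleC 0 u = 0"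
  and scaleC_zero_right [simp]: "scaleC c 0 = 0"
  and scaleC_scaleC [simp]: "scaleC c (scaleC d u) = scaleC (c * d) u"
  and scaleC_add_right: "scaleC c (u + v) = scaleC c u + scaleC c v"
  and scaleC_diff_right: "scaleC c (u - v) = scaleC c u - scaleC c v"
  and scaleC_add_left: "scaleC (c + d) u = scaleC c u + scaleC d u"
  and scaleC_minus_left: "scaleC (- c) u = - scaleC c u"
  and scaleR_scaleC: "r *\<^sub>R u = scaleC (complex_of_real r) u"
  by (rule ell2_eqI; simp add: algebra_simps scaleR_conv_of_real)+

lemma norm_scaleC [simp]: "norm (scaleC c u) = norm c * norm u"
proof -
  have "(norm (scaleC c u))\<^sup>2 = (norm c * norm u)\<^sup>2"
    by (simp add: norm_ell2_square power_mult_distrib norm_mult infsum_cmult_right')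
  then show ?thesis
    by (rule power2_eq_imp_eq) auto
qed

lemma norm_delta [simp]: "norm (delta n) = 1"
  unfolding norm_eq_sqrt_inner inner_delta_left by (simp add: coord_delta)

lemma bounded_linear_scaleC: "bounded_linear (scaleC c)"
  by (rule bounded_linear_intro[where K="norm c"])
    (auto simp: scaleC_add_right scaleR_scaleC mult.commute)

text \<open>Coordinatewise limits exist, and the Cauchy estimate for finite partial sums survives
  the passage to the limit; this gives both square-summability and norm convergence. Completeness
  serves the Banach fixed point theorem and limits of operators.\<close>

instance ell2 :: (type) banach
proof
  fix X :: "nat \<Rightarrow> 'a ell2"
  assume X: "Cauchy X"
  have "Cauchy (\<lambda>k. coord (X k) n)" for n
  proof (rule CauchyI)
    fix e :: real assume "0 < e"
    then obtain N where "\<forall>m\<ge>N. \<forall>k\<ge>N. norm (X m - X k) < e"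
      using X by (auto dest: CauchyD)
    moreover have "norm (coord (X m) n - coord (X k) n) \<le> norm (X m - X k)" for m k
      using norm_coord_le[of "X m - X k" n] by simp
    ultimately show "\<exists>M. \<forall>m\<ge>M. \<forall>k\<ge>M. norm (coord (X m) n - coord (X k) n) < e"
      by (meson le_less_trans)
  qed
  then have "\<exists>l. (\<lambda>k. coord (X k) n) \<longlonglongrightarrow> l" for n
    using Cauchy_convergent convergent_def by blast
  then obtain x where x: "\<And>n. (\<lambda>k. coord (X k) n) \<longlonglongrightarrow> x n"
    by metis
  have partial: "(\<Sum>n\<in>F. (norm (x n - coord (X k) n))\<^sup>2) \<le> e\<^sup>2"
    if "finite F" and le_e: "\<And>m. m \<ge> N \<Longrightarrow> norm (X m - X k) \<le> e" and "0 \<le> e" for F k N and e :: real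
  proof (rule tendsto_upperbound)
    show "(\<lambda>m. \<Sum>n\<in>F. (norm (coord (X m) n - coord (X k) n))\<^sup>2)
        \<longlonglongrightarrow> (\<Sum>n\<in>F. (norm (x n - coord (X k) n))\<^sup>2)"
      by (intro tendsto_intros x)
    have "(\<Sum>n\<in>F. (norm (coord (X m) n - coord (X k) n))\<^sup>2) \<le> e\<^sup>2" if "m \<ge> N" for m
    proof -
      have "(\<Sum>n\<in>F. (norm (coord (X m) n - coord (X k) n))\<^sup>2) \<le> (norm (X m - X k))\<^sup>2"
        using sum_coord_le[OF \<open>finite F\<close>, of "X m - X k"] by simp
      also have "\<dots> \<le> e\<^sup>2"
        by (rule power_mono[OF le_e[OF that] norm_ge_zero])
      finally show ?thesis .
    qed
    then show "\<forall>\<^sub>F m in sequentially. (\<Sum>n\<in>F. (norm (coord (X m) n - coord (X k) n))\<^sup>2) \<le> e\<^sup>2"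
      by (rule eventually_sequentiallyI)
  qed simp
  have summ: "(\<lambda>n. (norm (x n - coord (X k) n))\<^sup>2) summable_on UNIV"
    if "\<And>m. m \<ge> N \<Longrightarrow> norm (X m - X k) \<le> e" "0 \<le> e" for k N and e :: real
    by (rule nonneg_bdd_above_summable_on) (use partial that in \<open>auto intro!: bdd_aboveI2\<close>)
  obtain N0 where "\<forall>m\<ge>N0. \<forall>k\<ge>N0. norm (X m - X k) < 1"
    using CauchyD[OF X, of 1] by auto
  then have "(\<lambda>n. (norm ((x n - coord (X N0) n) + coord (X N0) n))\<^sup>2) summable_on UNIV"
    by (intro ell2_add_closed summable_coord summ[of N0 N0 1]) (auto intro: less_imp_le)
  then have coord_L: "coord (Abs_ell2 x) = x"
    by (simp add: Abs_ell2_inverse)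
  have "X \<longlonglongrightarrow> Abs_ell2 x"
  proof (rule LIMSEQ_I)
    fix r :: real assume "0 < r"
    then obtain N where N: "\<forall>m\<ge>N. \<forall>k\<ge>N. norm (X m - X k) < r / 2"
      using CauchyD[OF X, of "r / 2"] by auto
    have "norm (X k - Abs_ell2 x) < r" if "k \<ge> N" for k
    proof -
      have *: "norm (X m - X k) \<le> r / 2" if "m \<ge> N" for m
        using N \<open>k \<ge> N\<close> that by (auto intro: less_imp_le)
      have "(norm (Abs_ell2 x - X k))\<^sup>2 \<le> (r / 2)\<^sup>2"
        unfolding norm_ell2_square coord_diff coord_L
        by (rule infsum_le_finite_sums[OF summ[OF *]]) (use partial[OF _ *] \<open>0 < r\<close> in auto)
      then show ?thesis
        using \<open>0 < r\<close> power2_le_imp_le[of "norm (Abs_ell2 x - X k)" "r/2"]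
        by (simp add: norm_minus_commute)
    qed
    then show "\<exists>no. \<forall>n\<ge>no. norm (X n - Abs_ell2 x) < r"
      by blast
  qed
  then show "convergent X"
    by (rule convergentI)
qed

section \<open>Spectra of bounded operators\<close>

lemma bounded_clinearI:
  assumes "bounded_linear A" "\<And>c u. A (scaleC c u) = scaleC c (A u)"
  shows "bounded_clinear A"
  using assms by (simp add: bounded_clinear_def)

lemma
  assumes "bounded_clinear A"
  shows bounded_clinear_linear: "bounded_linear A"
    and bounded_clinear_add: "A (u + v) = A u + A v"
    and bounded_clinear_diff: "A (u - v) = A u - A v"
    and bounded_clinear_scaleC: "A (scaleC c u) = scaleC c (A u)"
    and bounded_clinear_zero: "A 0 = 0"
    and bounded_clinear_onorm: "norm (A u) \<le> onorm A * norm u"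
proof -
  show A: "bounded_linear A" and "A (scaleC c u) = scaleC c (A u)"
    using assms by (auto simp: bounded_clinear_def)
  interpret bounded_linear A by (rule A)
  show "A (u + v) = A u + A v" "A (u - v) = A u - A v" "A 0 = 0" "norm (A u) \<le> onorm A * norm u"
    by (rule add diff zero onorm[OF A])+
qed

lemma bounded_clinear_minus_scaleC:
  assumes "bounded_clinear A"
  shows "bounded_clinear (\<lambda>u. A u - scaleC z u)"
proof (rule bounded_clinearI)
  show "bounded_linear (\<lambda>u. A u - scaleC z u)"
    by (rule bounded_linear_sub[OF bounded_clinear_linear[OF assms] bounded_linear_scaleC])
qed (simp add: bounded_clinear_scaleC[OF assms] scaleC_diff_right mult.commute)

text \<open>Solving \<open>D u = v\<close> by iterating the contraction \<open>u \<mapsto> u - \<tau> (D u - v)\<close> avoids the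
  orthogonal projection theorem.\<close>
lemma bounded_clinear_inverse_if_contraction:
  fixes D :: "'a ell2 \<Rightarrow> 'a ell2"
  assumes D: "bounded_clinear D" and \<tau>: "\<tau> \<noteq> 0" and c: "0 \<le> c" "c < 1"
    and contr: "\<And>u. norm (u - scaleC \<tau> (D u)) \<le> c * norm u"
  shows "\<exists>R. bounded_clinear R \<and> (\<forall>u. R (D u) = u) \<and> (\<forall>u. D (R u) = u)"
proof -
  have "\<exists>!u. D u = v" for v
  proof -
    have "\<exists>!u. u - scaleC \<tau> (D u) + scaleC \<tau> v = u"
    proof (rule banach_fix_type[OF c], intro allI)
      fix x y
      have "(x - scaleC \<tau> (D x) + scaleC \<tau> v) - (y - scaleC \<tau> (D y) + scaleC \<tau> v)
          = (x - y) - scaleC \<tau> (D (x - y))"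
        by (simp add: bounded_clinear_diff[OF D] scaleC_diff_right)
      then show "dist (x - scaleC \<tau> (D x) + scaleC \<tau> v) (y - scaleC \<tau> (D y) + scaleC \<tau> v)
          \<le> c * dist x y"
        unfolding dist_norm by (simp only: contr)
    qed
    moreover have "u - scaleC \<tau> (D u) + scaleC \<tau> v = u \<longleftrightarrow> D u = v" for u
    proof
      assume "u - scaleC \<tau> (D u) + scaleC \<tau> v = u"
      then have "scaleC \<tau> (D u) = scaleC \<tau> v"
        by (simp add: algebra_simps)
      then have "scaleC (inverse \<tau>) (scaleC \<tau> (D u)) = scaleC (inverse \<tau>) (scaleC \<tau> v)"
        by simp
      then show "D u = v"
        using \<tau> by simp
    qed simp
    ultimately show ?thesis
      by simp
  qed
  then obtain R where DR: "\<And>v. D (R v) = v" and uniq: "\<And>u v. D u = v \<Longrightarrow> u = R v"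
    by metis
  have "bounded_linear R"
  proof (rule bounded_linear_intro[where K="norm \<tau> / (1 - c)"])
    show "R (x + y) = R x + R y" for x y
      by (rule uniq[symmetric]) (simp add: bounded_clinear_add[OF D] DR)
    show "R (r *\<^sub>R x) = r *\<^sub>R R x" for r x
      by (rule uniq[symmetric]) (simp add: scaleR_scaleC bounded_clinear_scaleC[OF D] DR)
    show "norm (R x) \<le> norm x * (norm \<tau> / (1 - c))" for x
    proof -
      have "norm (R x) \<le> norm (R x - scaleC \<tau> x) + norm (scaleC \<tau> x)"
        using norm_triangle_ineq[of "R x - scaleC \<tau> x" "scaleC \<tau> x"] by simp
      also have "\<dots> \<le> c * norm (R x) + norm \<tau> * norm x"
        using contr[of "R x"] by (simp add: DR)
      finally show ?thesis
        using c by (simp add: field_simps)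
    qed
  qed
  then have "bounded_clinear R"
    by (rule bounded_clinearI) (rule uniq[symmetric], simp add: bounded_clinear_scaleC[OF D] DR)
  then show ?thesis
    using DR uniq by metis
qed

lemma not_in_spectrum_if_contraction:
  assumes A: "bounded_clinear A" and \<tau>: "\<tau> \<noteq> 0" and c: "0 \<le> c" "c < 1"
    and contr: "\<And>u. norm (u - scaleC \<tau> (A u - scaleC z u)) \<le> c * norm u"
  shows "z \<notin> spectrum A"
  using bounded_clinear_inverse_if_contraction[OF bounded_clinear_minus_scaleC[OF A] \<tau> c contr]
  by (auto simp: spectrum_def)

text \<open>For \<open>z\<close> beyond the norm, the choice \<open>\<tau> = - inverse z\<close>
  reduces \<open>u - scaleC \<tau> (A u - scaleC z u)\<close> to \<open>A u\<close> divided by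
  \<open>z\<close>, which contracts by the factor \<open>onorm A / norm z\<close>.\<close>

lemma norm_spectrum_le:
  assumes A: "bounded_clinear A" and z: "z \<in> spectrum A"
  shows "norm z \<le> onorm A"
proof (rule ccontr)
  assume "\<not> norm z \<le> onorm A"
  then have z_gt: "onorm A < norm z"
    by simp
  have A0: "0 \<le> onorm A"
    by (rule onorm_pos_le[OF bounded_clinear_linear[OF A]])
  with z_gt have "z \<noteq> 0"
    by auto
  have "z \<notin> spectrum A"
  proof (rule not_in_spectrum_if_contraction[OF A, of "- inverse z" "onorm A / norm z"])
    show "- inverse z \<noteq> 0" "0 \<le> onorm A / norm z" "onorm A / norm z < 1"
      using \<open>z \<noteq> 0\<close> z_gt A0 by auto
    fix u :: "'a ell2"
    have "u - scaleC (- inverse z) (A u - scaleC z u) = scaleC (inverse z) (A u)"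
      by (rule ell2_eqI) (use \<open>z \<noteq> 0\<close> in \<open>simp add: field_simps\<close>)
    then have "norm (u - scaleC (- inverse z) (A u - scaleC z u)) = norm (A u) / norm z"
      by (simp add: norm_inverse divide_inverse)
    also have "\<dots> \<le> onorm A / norm z * norm u"
      using bounded_clinear_onorm[OF A, of u] \<open>z \<noteq> 0\<close> by (simp add: field_simps)
    finally show "norm (u - scaleC (- inverse z) (A u - scaleC z u)) \<le> onorm A / norm z * norm u" .
  qed
  with z show False
    by blast
qed

section \<open>Self-adjoint operators and the reality of their spectrum\<close>

lemma inner_scaleC_self: "inner u (scaleC c u) = Re c * (norm u)\<^sup>2"
proof -
  \<comment> \<open>Multiplication by \<i> is skew for the real inner product, so it sends
    \<open>u\<close> to a vector orthogonal to \<open>u\<close>.\<close>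
  have "inner u (scaleC \<i> u) = - inner u (scaleC \<i> u)"
    using inner_scaleC_left[of \<i> u u] by (simp add: scaleC_minus_left inner_commute)
  then have i: "inner u (scaleC \<i> u) = 0"
    by simp
  have "scaleC c u = Re c *\<^sub>R u + Im c *\<^sub>R scaleC \<i> u"
    by (rule ell2_eqI) (simp add: complex_eq_iff)
  then show ?thesis
    by (simp add: inner_add_right i power2_norm_eq_inner)
qed

text \<open>Symmetry is required for the real inner product only. Since \<open>A\<close> is complex
  linear, replacing \<open>v\<close> by \<open>scaleC \<i> v\<close> recovers the imaginary part of
  the identity for \<open>cinner\<close>.\<close>

definition self_adjoint :: "('a ell2 \<Rightarrow> 'a ell2) \<Rightarrow> bool" where
  "self_adjoint A \<longleftrightarrow> bounded_clinear A \<and> (\<forall>u v. inner (A u) v = inner u (A v))"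

lemma self_adjoint_bounded_clinear: "self_adjoint A \<Longrightarrow> bounded_clinear A"
  and self_adjoint_inner: "self_adjoint A \<Longrightarrow> inner (A u) v = inner u (A v)"
  by (auto simp: self_adjoint_def)

lemma inner_scaleC_i_self_adjoint:
  assumes "self_adjoint A"
  shows "inner u (scaleC \<i> (A u)) = 0"
proof -
  have "inner u (scaleC \<i> (A u)) = inner (A u) (scaleC \<i> u)"
    using assms by (simp add: self_adjoint_def bounded_clinear_def)
  also have "\<dots> = - inner u (scaleC \<i> (A u))"
    using inner_scaleC_left[of \<i> u "A u"] by (simp add: scaleC_minus_left inner_commute)
  finally show ?thesis
    by simp
qed

text \<open>For a purely imaginary \<tau>, neither \<open>A\<close> nor \<open>Re z\<close>
  contributes to the cross term of the square of \<open>norm (u - w)\<close>. What remains is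
  proportional to \<open>Im z\<close>, and the sign of \<tau> can be chosen to make a
  contraction.\<close>

lemma spectrum_self_adjoint_real:
  assumes A: "self_adjoint A" and z: "z \<in> spectrum A"
  shows "Im z = 0"
proof (rule ccontr)
  assume b: "Im z \<noteq> 0"
  define D where "D = (\<lambda>u. A u - scaleC z u)"
  have D: "bounded_clinear D"
    unfolding D_def by (rule bounded_clinear_minus_scaleC[OF self_adjoint_bounded_clinear[OF A]])
  \<comment> \<open>The summand \<open>\<bar>Im z\<bar>\<close> makes \<open>K\<close> positive and
    keeps the expression under the square root below nonnegative.\<close>
  define K where "K = onorm D + \<bar>Im z\<bar>"
  \<comment> \<open>The minimiser of
    \<open>1 - 2 * (s * Im z) + s\<^sup>2 * K\<^sup>2\<close>.\<close>
  define s where "s = Im z / K\<^sup>2"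
  have "0 \<le> onorm D"
    by (rule onorm_pos_le[OF bounded_clinear_linear[OF D]])
  then have K: "0 < K" "\<bar>Im z\<bar> \<le> K" "onorm D \<le> K"
    using b by (auto simp: K_def)
  have c_nonneg: "0 \<le> 1 - (Im z)\<^sup>2 / K\<^sup>2"
    using K power_mono[of "\<bar>Im z\<bar>" K 2] by (simp add: field_simps)
  have "z \<notin> spectrum A"
  proof (rule not_in_spectrum_if_contraction[OF self_adjoint_bounded_clinear[OF A]])
    show "\<i> * complex_of_real s \<noteq> 0" "0 \<le> sqrt (1 - (Im z)\<^sup>2 / K\<^sup>2)" "sqrt (1 - (Im z)\<^sup>2 / K\<^sup>2) < 1"
      using b K c_nonneg by (auto simp: s_def)
    fix u
    define w where "w = scaleC (\<i> * complex_of_real s) (D u)"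
    have "w = s *\<^sub>R scaleC \<i> (A u) - scaleC (\<i> * complex_of_real s * z) u"
      unfolding w_def D_def by (rule ell2_eqI) (simp add: scaleR_conv_of_real algebra_simps)
    then have uw: "inner u w = s * Im z * (norm u)\<^sup>2"
      by (simp add: inner_diff_right inner_scaleC_self inner_scaleC_i_self_adjoint[OF A])
    have "norm w \<le> \<bar>s\<bar> * (K * norm u)"
      using order_trans[OF bounded_clinear_onorm[OF D, of u] mult_right_mono[OF K(3) norm_ge_zero]]
      by (simp add: w_def norm_mult mult_left_mono)
    then have "(norm w)\<^sup>2 \<le> (\<bar>s\<bar> * (K * norm u))\<^sup>2"
      by (rule power_mono) simp
    then have w2: "(norm w)\<^sup>2 \<le> s\<^sup>2 * K\<^sup>2 * (norm u)\<^sup>2"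
      by (simp add: power_mult_distrib mult.assoc)
    have "(norm (u - w))\<^sup>2 = (norm u)\<^sup>2 - 2 * inner u w + (norm w)\<^sup>2"
      unfolding power2_norm_eq_inner by (simp only: inner_diff_left inner_diff_right inner_commute[of w u])
    also have "\<dots> \<le> (1 - 2 * (s * Im z) + s\<^sup>2 * K\<^sup>2) * (norm u)\<^sup>2"
      using w2 uw by (simp add: algebra_simps)
    also have "1 - 2 * (s * Im z) + s\<^sup>2 * K\<^sup>2 = 1 - (Im z)\<^sup>2 / K\<^sup>2"
      using K(1) by (simp add: s_def power2_eq_square field_simps)
    finally have "(norm (u - w))\<^sup>2 \<le> (sqrt (1 - (Im z)\<^sup>2 / K\<^sup>2) * norm u)\<^sup>2"
      using c_nonneg by (simp add: power_mult_distrib)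
    then show "norm (u - scaleC (\<i> * complex_of_real s) (A u - scaleC z u))
        \<le> sqrt (1 - (Im z)\<^sup>2 / K\<^sup>2) * norm u"
      unfolding w_def D_def by (rule power2_le_imp_le) (use c_nonneg in auto)
  qed
  with z show False
    by blast
qed

section \<open>Polynomials of an operator\<close>

lemma poly_op_extend:
  assumes "degree p \<le> n"
  shows "poly_op p A u = (\<Sum>i\<le>n. scaleC (coeff p i) ((A ^^ i) u))"
  unfolding poly_op_def
  by (rule sum.mono_neutral_left) (use assms in \<open>auto simp: not_le coeff_eq_0\<close>)

lemma poly_op_0 [simp]: "poly_op 0 A u = 0"
  by (simp add: poly_op_def)

text \<open>The Horner recursion, which drives the inductions over coefficients below.\<close>

lemma poly_op_pCons:
  assumes A: "bounded_clinear A"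
  shows "poly_op (pCons a p) A u = scaleC a u + A (poly_op p A u)"
proof -
  have "poly_op (pCons a p) A u
      = (\<Sum>i\<le>Suc (degree p). scaleC (coeff (pCons a p) i) ((A ^^ i) u))"
    by (rule poly_op_extend) (simp add: degree_pCons_le)
  also have "\<dots> = scaleC a u + (\<Sum>i\<le>degree p. scaleC (coeff p i) ((A ^^ Suc i) u))"
    by (simp add: sum.atMost_Suc_shift del: sum.atMost_Suc)
  also have "(\<Sum>i\<le>degree p. scaleC (coeff p i) ((A ^^ Suc i) u)) = A (poly_op p A u)"
    unfolding poly_op_def
    by (simp add: linear_sum[OF bounded_linear.linear[OF bounded_clinear_linear[OF A]]]
        bounded_clinear_scaleC[OF A])
  finally show ?thesis .
qed

lemma bounded_clinear_poly_op:
  assumes A: "bounded_clinear A"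
  shows "bounded_clinear (poly_op p A)"
proof (induction p)
  case 0
  show ?case
    by (simp add: bounded_clinear_def poly_op_def bounded_linear_zero)
next
  case (pCons a p)
  have "bounded_linear (\<lambda>u. scaleC a u + A (poly_op p A u))"
    by (intro bounded_linear_add bounded_linear_scaleC
        bounded_linear_compose[OF bounded_clinear_linear[OF A]] bounded_clinear_linear pCons)
  then show ?case
    by (simp add: bounded_clinear_def poly_op_pCons[OF A] bounded_clinear_scaleC[OF A]
        bounded_clinear_scaleC[OF pCons(2)] scaleC_add_right mult.commute)
qed

context
  fixes A :: "'a ell2 \<Rightarrow> 'a ell2"
  assumes A: "bounded_clinear A"
begin

lemma poly_op_const: "poly_op [:a:] A u = scaleC a u"
  by (simp add: poly_op_pCons[OF A] bounded_clinear_zero[OF A])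

lemma poly_op_linear: "poly_op [:-z, 1:] A u = A u - scaleC z u"
  by (simp add: poly_op_pCons[OF A] bounded_clinear_zero[OF A] scaleC_minus_left)

lemma poly_op_add: "poly_op (p + q) A u = poly_op p A u + poly_op q A u"
  by (induction p q rule: poly_induct2)
    (simp_all add: poly_op_pCons[OF A] bounded_clinear_add[OF A] scaleC_add_left)

lemma poly_op_smult: "poly_op (smult c p) A u = scaleC c (poly_op p A u)"
  by (induction p)
    (simp_all add: poly_op_pCons[OF A] bounded_clinear_scaleC[OF A] scaleC_add_right)

lemma poly_op_diff: "poly_op (p - q) A u = poly_op p A u - poly_op q A u"
  using poly_op_add[of "p - q" q u] by simp

lemma poly_op_mult: "poly_op (p * q) A u = poly_op p A (poly_op q A u)"
  by (induction p) (simp_all add: poly_op_pCons[OF A] poly_op_add poly_op_smult)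

lemma poly_op_commute: "poly_op p A (poly_op q A u) = poly_op q A (poly_op p A u)"
  by (metis poly_op_mult mult.commute)

text \<open>Over the complex numbers \<open>p\<close> splits into linear factors. Each factor
  \<open>A - z\<close> has a bounded inverse, so it shrinks norms by at most a constant, and these
  constants multiply.\<close>

lemma poly_op_bounded_below:
  assumes "p \<noteq> 0" and "\<And>z. poly p z = 0 \<Longrightarrow> z \<notin> spectrum A"
  shows "\<exists>c>0. \<forall>u. c * norm u \<le> norm (poly_op p A u)"
  using assms
proof (induction "degree p" arbitrary: p)
  case 0
  then obtain a where p: "p = [:a:]" "a \<noteq> 0"
    by (metis degree_eq_zeroE pCons_0_0)
  then show ?case
    by (intro exI[of _ "norm a"]) (simp add: poly_op_const)
next
  case (Suc n)
  then obtain z where z: "poly p z = 0"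
    by (metis fundamental_theorem_of_algebra constant_degree nat.distinct(1))
  then obtain q where q: "p = [:-z, 1:] * q"
    by (auto simp: poly_eq_0_iff_dvd)
  with Suc.prems have "q \<noteq> 0"
    by auto
  then have "n = degree q"
    using Suc.hyps(2) by (simp add: q degree_mult_eq del: mult_pCons_left)
  then obtain c where c: "c > 0" "\<And>u. c * norm u \<le> norm (poly_op q A u)"
    using Suc.hyps(1)[OF _ \<open>q \<noteq> 0\<close>] Suc.prems(2) unfolding q by auto
  obtain R where R: "bounded_clinear R" "\<And>u. R (A u - scaleC z u) = u"
    using Suc.prems(2)[OF z] unfolding spectrum_def by auto
  \<comment> \<open>The added \<open>1\<close> keeps \<open>K\<close> positive without an argument
    that \<open>R\<close> is nonzero.\<close>
  define K where "K = onorm R + 1"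
  have K: "K > 0"
    using onorm_pos_le[OF bounded_clinear_linear[OF R(1)]] by (simp add: K_def)
  have "c / K * norm u \<le> norm (poly_op p A u)" for u
  proof -
    have "c * norm u \<le> norm (R (poly_op p A u))"
      using c(2) by (simp only: q poly_op_mult poly_op_linear R(2))
    also have "\<dots> \<le> onorm R * norm (poly_op p A u)"
      by (rule bounded_clinear_onorm[OF R(1)])
    also have "\<dots> \<le> K * norm (poly_op p A u)"
      by (rule mult_right_mono) (simp_all add: K_def)
    finally show ?thesis
      using K by (simp add: field_simps)
  qed
  then show ?case
    using c(1) K by (intro exI[of _ "c / K"]) auto
qed

text \<open>Spectral inclusion: \<open>p - p(z)\<close> is divisible by the linear factor at
  \<open>z\<close>, so an inverse of \<open>p(A) - p(z)\<close> would yield one of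
  \<open>A - z\<close>. Such an inverse exists when \<open>p(z)\<close> exceeds the norm of
  \<open>p(A)\<close>.\<close>

lemma norm_poly_spectrum_le:
  assumes E: "z \<in> spectrum A"
  shows "norm (poly p z) \<le> onorm (poly_op p A)"
proof (rule ccontr)
  assume "\<not> norm (poly p z) \<le> onorm (poly_op p A)"
  then have gt: "onorm (poly_op p A) < norm (poly p z)"
    by simp
  note pA = bounded_clinear_poly_op[OF A]
  have "\<not> poly p z \<in> spectrum (poly_op p A)"
    using norm_spectrum_le[OF pA, of "poly p z" p] gt by auto
  then obtain R where R: "bounded_clinear R" "\<And>u. R (poly_op p A u - scaleC (poly p z) u) = u"
    "\<And>u. poly_op p A (R u) - scaleC (poly p z) (R u) = u"
    unfolding spectrum_def by auto
  have "poly (p - [:poly p z:]) z = 0"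
    by simp
  then obtain q where q: "p - [:poly p z:] = [:-z, 1:] * q"
    unfolding poly_eq_0_iff_dvd by auto
  have minus_eq: "poly_op p A u - scaleC (poly p z) u = poly_op ([:-z, 1:] * q) A u" for u
    by (simp only: q[symmetric] poly_op_diff poly_op_const)
  note R = R[unfolded minus_eq]
  define S where "S = (\<lambda>u. poly_op q A (R u))"
  have "bounded_clinear S"
    unfolding S_def bounded_clinear_def
    using bounded_linear_compose[OF bounded_clinear_linear[OF pA] bounded_clinear_linear[OF R(1)]]
    by (auto simp: bounded_clinear_scaleC[OF pA] bounded_clinear_scaleC[OF R(1)])
  moreover have right: "A (S u) - scaleC z (S u) = u" for u
    using R(3)[of u] by (simp only: poly_op_mult poly_op_linear S_def)
  \<comment> \<open>Applying \<open>q(A)\<close> and then \<open>R\<close> is a left inverse of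
    \<open>A - z\<close>, while \<open>S\<close> is a right inverse. The two must agree, which
    spares a proof that \<open>R\<close> commutes with \<open>q(A)\<close>.\<close>
  moreover have left: "S (A u - scaleC z u) = u" for u
  proof -
    have left': "R (poly_op q A (A u - scaleC z u)) = u" for u
      using R(2)[of u] by (simp only: poly_op_mult poly_op_linear mult.commute[of _ q])
    have "S (A u - scaleC z u) = R (poly_op q A (A (S (A u - scaleC z u)) - scaleC z (S (A u - scaleC z u))))"
      by (rule left'[symmetric])
    then show ?thesis
      by (simp only: right left')
  qed
  ultimately have "z \<notin> spectrum A"
    unfolding spectrum_def by blast
  with E show False
    by blast
qed

end

section \<open>Norms of polynomials of a self-adjoint operator\<close>

lemma inner_poly_op_adjoint:
  assumes "self_adjoint A"
  shows "inner (poly_op p A u) v = inner u (poly_op (map_poly cnj p) A v)"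
proof (induction p arbitrary: u v)
  case (pCons a p)
  note A = self_adjoint_bounded_clinear[OF assms]
  \<comment> \<open>The recursion has \<open>A\<close> outermost, but moving it across the inner
    product makes it act first.\<close>
  have comm: "poly_op q A (A v) = A (poly_op q A v)" for q v
    using poly_op_commute[OF A, of q "[:0, 1:]" v] poly_op_linear[OF A, of 0] by simp
  show ?case
    by (simp add: map_poly_pCons poly_op_pCons[OF A] inner_add_left inner_add_right
        inner_scaleC_left self_adjoint_inner[OF assms] pCons comm)
qed simp

context
  fixes A :: "'a ell2 \<Rightarrow> 'a ell2"
  assumes sa: "self_adjoint A"
begin

private lemma A: "bounded_clinear A"
  by (rule self_adjoint_bounded_clinear[OF sa])

text \<open>Otherwise \<open>q(A) - \<lambda>\<^sup>2\<close> with \<open>q = cnj p p\<close> is bounded below; but \<open>\<parallel>(q(A) - \<lambda>\<^sup>2) u\<parallel>\<^sup>2\<close> is at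
  most \<open>\<lambda>\<^sup>2 (\<lambda>\<^sup>2 \<parallel>u\<parallel>\<^sup>2 - \<parallel>p(A) u\<parallel>\<^sup>2)\<close>, which is small when \<open>u\<close> nearly attains the norm \<open>\<lambda>\<close> of \<open>p(A)\<close>.\<close>
lemma spectrum_point_attaining_onorm:
  fixes p :: "complex poly"
  defines "r \<equiv> map_poly cnj p * p - [:complex_of_real ((onorm (poly_op p A))\<^sup>2):]"
  assumes pos: "0 < onorm (poly_op p A)" and "r \<noteq> 0"
  shows "\<exists>z\<in>spectrum A. poly r z = 0"
proof (rule ccontr)
  assume no: "\<not> (\<exists>z\<in>spectrum A. poly r z = 0)"
  define L where "L = onorm (poly_op p A)"
  have L: "0 < L" "\<And>u. norm (poly_op p A u) \<le> L * norm u"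
    using pos bounded_clinear_onorm[OF bounded_clinear_poly_op[OF A]] by (auto simp: L_def)
  define P where "P = poly_op p A"
  define P' where "P' = poly_op (map_poly cnj p) A"
  have adj: "inner (P u) v = inner u (P' v)" for u v
    unfolding P_def P'_def by (rule inner_poly_op_adjoint[OF sa])
  \<comment> \<open>The adjoint obeys the same norm bound as \<open>P\<close>, by pairing
    \<open>P' v\<close> with itself.\<close>
  have P'_le: "norm (P' v) \<le> L * norm v" for v
  proof -
    have "norm (P' v) * norm (P' v) = inner (P (P' v)) v"
      unfolding adj by (simp only: power2_norm_eq_inner power2_eq_square[symmetric])
    also have "\<dots> \<le> norm (P (P' v)) * norm v"
      by (rule norm_cauchy_schwarz)
    also have "\<dots> \<le> L * norm (P' v) * norm v"
      by (rule mult_right_mono) (use L in \<open>auto simp: P_def\<close>)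
    finally have "norm (P' v) * norm (P' v) \<le> norm (P' v) * (L * norm v)"
      by (simp add: ac_simps)
    then show ?thesis
      using L(1) by (cases "norm (P' v) = 0") (auto simp: mult_le_cancel_left)
  qed
  obtain c where c: "c > 0" "\<And>u. c * norm u \<le> norm (poly_op r A u)"
    using poly_op_bounded_below[OF A \<open>r \<noteq> 0\<close>] no by auto
  \<comment> \<open>In the expanded square the cross term is \<open>(norm (P u))\<^sup>2\<close>.
    The lower bound \<open>c\<close> for \<open>r(A)\<close> thus becomes a strict improvement of
    the norm bound \<open>L\<close> for \<open>P\<close>.\<close>
  have bound: "(norm (P u))\<^sup>2 \<le> (L\<^sup>2 - c\<^sup>2 / L\<^sup>2) * (norm u)\<^sup>2" for u
  proof -
    have r: "poly_op r A u = P' (P u) - L\<^sup>2 *\<^sub>R u"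
      unfolding r_def P_def P'_def L_def
      by (simp add: poly_op_diff[OF A] poly_op_mult[OF A] poly_op_const[OF A] scaleR_scaleC)
    have "(c * norm u)\<^sup>2 \<le> (norm (P' (P u) - L\<^sup>2 *\<^sub>R u))\<^sup>2"
      using c by (intro power_mono) (auto simp flip: r)
    also have "\<dots> = (norm (P' (P u)))\<^sup>2 - 2 * L\<^sup>2 * inner u (P' (P u)) + L\<^sup>2 * L\<^sup>2 * (norm u)\<^sup>2"
      unfolding power2_norm_eq_inner inner_diff_left inner_diff_right inner_scaleR_left
        inner_scaleR_right inner_commute[of "P' (P u)" u]
      by (simp add: right_diff_distrib mult.assoc)
    also have "inner u (P' (P u)) = (norm (P u))\<^sup>2"
      by (simp only: adj[symmetric] power2_norm_eq_inner)
    also have "(norm (P' (P u)))\<^sup>2 \<le> (L * norm (P u))\<^sup>2"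
      using P'_le by (intro power_mono) auto
    finally have "L\<^sup>2 * (norm (P u))\<^sup>2 \<le> (L\<^sup>2 * L\<^sup>2 - c\<^sup>2) * (norm u)\<^sup>2"
      by (simp add: algebra_simps power_mult_distrib)
    then show ?thesis
      using L(1) by (simp add: field_simps)
  qed
  \<comment> \<open>Any unit vector would do here; its norm turns \<open>bound\<close> into a
    statement about the factor alone.\<close>
  have nonneg: "0 \<le> L\<^sup>2 - c\<^sup>2 / L\<^sup>2"
    using order_trans[OF zero_le_power2 bound[of "delta undefined"]] by simp
  have "onorm P \<le> sqrt (L\<^sup>2 - c\<^sup>2 / L\<^sup>2)"
  proof (rule onorm_bound)
    fix u
    show "norm (P u) \<le> sqrt (L\<^sup>2 - c\<^sup>2 / L\<^sup>2) * norm u"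
      by (rule power2_le_imp_le) (use bound[of u] nonneg in \<open>auto simp: power_mult_distrib\<close>)
  qed (use nonneg in simp)
  then have "L \<le> sqrt (L\<^sup>2 - c\<^sup>2 / L\<^sup>2)"
    by (simp only: L_def P_def)
  then have "L\<^sup>2 \<le> (sqrt (L\<^sup>2 - c\<^sup>2 / L\<^sup>2))\<^sup>2"
    using L(1) by (intro power_mono) auto
  then show False
    using nonneg c(1) L(1) by (simp add: divide_le_0_iff)
qed

text \<open>The zero operator is not invertible because the space is nontrivial. For nonzero
  \<open>A\<close>, the preceding lemma applied to the identity polynomial provides a spectral
  point.\<close>

lemma spectrum_nonempty: "spectrum A \<noteq> {}"
proof (cases "onorm A = 0")
  case True
  then have "A u = 0" for u
    using onorm_eq_0[OF bounded_clinear_linear[OF A]] by blast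
  then have "R (A (delta undefined) - scaleC 0 (delta undefined)) = 0" if "bounded_clinear R" for R
    using bounded_clinear_zero[OF that] by simp
  moreover have "delta undefined \<noteq> 0"
    using norm_delta[of undefined] by (metis norm_zero zero_neq_one)
  ultimately have "0 \<in> spectrum A"
    unfolding spectrum_def by fastforce
  then show ?thesis
    by blast
next
  case False
  have "poly_op [:0, 1:] A = A"
    using poly_op_linear[OF A, of 0] by auto
  moreover have "0 < onorm A"
    using False onorm_pos_le[OF bounded_clinear_linear[OF A]] by simp
  ultimately show ?thesis
    using spectrum_point_attaining_onorm[of "[:0, 1:]"] by (auto simp: map_poly_pCons)
qed

text \<open>On the real spectrum, \<open>r\<close> takes the value \<open>|p(z)|^2 - L^2\<close>, so
  a root of \<open>r\<close> in the spectrum is a point where \<open>|p|\<close> equals the norm of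
  \<open>p(A)\<close>. With \<open>norm_poly_spectrum_le\<close> this yields the isometry behind the
  functional calculus.\<close>

lemma onorm_poly_op_le:
  assumes le: "\<And>z. z \<in> spectrum A \<Longrightarrow> norm (poly p z) \<le> c"
  shows "onorm (poly_op p A) \<le> c"
proof -
  obtain z0 where z0: "z0 \<in> spectrum A"
    using spectrum_nonempty by blast
  show ?thesis
  proof (cases "onorm (poly_op p A) = 0")
    case True
    then show ?thesis
      using z0 order_trans[OF norm_ge_zero le] by auto
  next
    case False
    define L where "L = onorm (poly_op p A)"
    have L: "0 < L"
      using False onorm_pos_le[OF bounded_clinear_linear[OF bounded_clinear_poly_op[OF A]], of p]
      by (simp add: L_def)
    define r where "r = map_poly cnj p * p - [:complex_of_real (L\<^sup>2):]"
    obtain z where z: "z \<in> spectrum A" "poly r z = 0"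
    proof (cases "r = 0")
      case True
      then show ?thesis
        using that z0 by simp
    next
      case False
      then show ?thesis
        using that spectrum_point_attaining_onorm[of p] L unfolding r_def L_def by blast
    qed
    have "cnj z = z"
      using spectrum_self_adjoint_real[OF sa z(1)] by (simp add: complex_eq_iff)
    then have "cnj (poly p z) * poly p z = complex_of_real (L\<^sup>2)"
      using z(2) by (simp add: r_def)
    then have "complex_of_real ((norm (poly p z))\<^sup>2) = complex_of_real (L\<^sup>2)"
      by (metis complex_norm_square mult.commute)
    then have "norm (poly p z) = L"
      using L by (simp only: of_real_eq_iff) (simp add: power2_eq_iff_nonneg)
    then show ?thesis
      using le[OF z(1)] by (simp add: L_def)
  qed
qed

end

section \<open>The continuous functional calculus\<close>

lemma poly_map_of_real: "poly (map_poly complex_of_real p) (of_real x) = of_real (poly p x)"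
  by (induction p) (auto simp: map_poly_pCons)

lemma map_poly_cnj_of_real [simp]:
  "map_poly cnj (map_poly complex_of_real p) = map_poly complex_of_real p"
  by (rule poly_eqI) (simp add: coeff_map_poly)

lemma uniform_polynomial_approximation:
  assumes "continuous_on UNIV g"
  shows "\<exists>p :: nat \<Rightarrow> real poly. \<forall>k. \<forall>x\<in>{-R..R}. \<bar>g x - poly (p k) x\<bar> < inverse (real (Suc k))"
proof -
  have "\<exists>p :: real poly. \<forall>x\<in>{-R..R}. \<bar>g x - poly p x\<bar> < inverse (real (Suc k))" for k
  proof -
    obtain q where q: "real_polynomial_function q"
        "\<And>x. x \<in> {-R..R} \<Longrightarrow> \<bar>g x - q x\<bar> < inverse (real (Suc k))"
      using Stone_Weierstrass_real_polynomial_function[of "{-R..R}" g "inverse (real (Suc k))"]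
        continuous_on_subset[OF assms subset_UNIV]
      by (metis compact_Icc inverse_positive_iff_positive of_nat_0_less_iff zero_less_Suc)
    obtain a n where "q = (\<lambda>x. \<Sum>i\<le>n::nat. a i * x ^ i)"
      using q(1) real_polynomial_function_imp_sum by blast
    then have "poly (\<Sum>i\<le>n. monom (a i) i) x = q x" for x
      by (simp add: poly_sum poly_monom)
    then show ?thesis
      using q(2) by metis
  qed
  then show ?thesis
    by metis
qed

lemma uniform_limit_polynomial_approximation:
  assumes "\<And>k x. x \<in> {-R..R} \<Longrightarrow> \<bar>g x - poly (p k) x\<bar> < inverse (real (Suc k))"
  shows "uniform_limit {-R..R} (\<lambda>k. poly (p k)) g sequentially"
proof (rule uniform_limitI)
  fix e :: real assume "0 < e"
  then obtain N where N: "inverse (real (Suc N)) < e"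
    using reals_Archimedean by blast
  have "\<forall>x\<in>{-R..R}. dist (poly (p k) x) (g x) < e" if "k \<ge> N" for k
  proof
    fix x assume "x \<in> {-R..R}"
    then have "dist (poly (p k) x) (g x) < inverse (real (Suc k))"
      using assms by (simp add: dist_real_def abs_minus_commute)
    also have "\<dots> \<le> inverse (real (Suc N))"
      using that by (intro le_imp_inverse_le) auto
    finally show "dist (poly (p k) x) (g x) < e"
      using N by simp
  qed
  then show "\<forall>\<^sub>F k in sequentially. \<forall>x\<in>{-R..R}. dist (poly (p k) x) (g x) < e"
    by (rule eventually_sequentiallyI)
qed

lemma uniform_limit_of_real:
  assumes "uniform_limit X f g F"
  shows "uniform_limit X (\<lambda>k x. complex_of_real (f k x)) (\<lambda>x. complex_of_real (g x)) F"
  using assms unfolding uniform_limit_iff by simp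

lemma tendsto_of_onorm_tendsto_0:
  assumes "\<And>k. bounded_clinear (F k)" "bounded_clinear B"
    and lim: "(\<lambda>k. onorm (\<lambda>u. F k u - B u)) \<longlonglongrightarrow> 0"
  shows "(\<lambda>k. F k u) \<longlonglongrightarrow> B u"
proof (subst LIM_zero_iff[symmetric], rule tendsto_0_le[OF lim])
  have bl: "bounded_linear (\<lambda>u. F k u - B u)" for k
    by (intro bounded_linear_sub bounded_clinear_linear assms)
  have "norm (F k u - B u) \<le> norm (onorm (\<lambda>u. F k u - B u)) * norm u" for k
    using onorm[OF bl, of k u] onorm_pos_le[OF bl, of k] by simp
  then show "\<forall>\<^sub>F k in sequentially. norm (F k u - B u) \<le> norm (onorm (\<lambda>u. F k u - B u)) * norm u"
    by simp
qed

context
  fixes A :: "'a ell2 \<Rightarrow> 'a ell2"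
  assumes sa: "self_adjoint A"
begin

private lemma clinear_A: "bounded_clinear A"
  by (rule self_adjoint_bounded_clinear[OF sa])

private abbreviation "X \<equiv> {x. complex_of_real x \<in> spectrum A}"

private lemma poly_op_linear_op: "bounded_linear (poly_op p A)"
  by (rule bounded_clinear_linear[OF bounded_clinear_poly_op[OF clinear_A]])

lemma onorm_poly_op_diff_le:
  assumes "\<And>x. x \<in> X \<Longrightarrow> norm (poly p (of_real x) - poly q (of_real x)) \<le> c"
  shows "onorm (\<lambda>u. poly_op p A u - poly_op q A u) \<le> c"
proof -
  have "onorm (poly_op (p - q) A) \<le> c"
  proof (rule onorm_poly_op_le[OF sa])
    fix z assume z: "z \<in> spectrum A"
    have "z = of_real (Re z)"
      using spectrum_self_adjoint_real[OF sa z] by (simp add: complex_eq_iff)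
    then show "norm (poly (p - q) z) \<le> c"
      using assms[of "Re z"] z by auto
  qed
  then show ?thesis
    by (simp add: poly_op_diff[OF clinear_A, abs_def])
qed

text \<open>Polynomials that are uniformly close on the spectrum are close in operator norm after
  inserting \<open>A\<close>. Hence \<open>p k\<close> gives a Cauchy sequence of operators, and
  every other approximating sequence has the same limit.\<close>

lemma cont_calculus_exists:
  assumes p: "uniform_limit X (\<lambda>k x. poly (p k) (of_real x)) g sequentially"
  shows "\<exists>B. bounded_clinear B \<and> (\<forall>p. uniform_limit X (\<lambda>k x. poly (p k) (of_real x)) g sequentially
        \<longrightarrow> (\<lambda>k. onorm (\<lambda>u. poly_op (p k) A u - B u)) \<longlonglongrightarrow> 0)"
proof -
  \<comment> \<open>Passing to the type of bounded operators makes its completeness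
    available.\<close>
  define L where "L = (\<lambda>k. Blinfun (poly_op (p k) A))"
  have L: "blinfun_apply (L k) = poly_op (p k) A" for k
    by (simp add: L_def bounded_linear_Blinfun_apply poly_op_linear_op)
  have "Cauchy L"
  proof (rule metric_CauchyI)
    fix e :: real assume "0 < e"
    then have "\<forall>\<^sub>F k in sequentially. \<forall>x\<in>X. dist (poly (p k) (of_real x)) (g x) < e / 4"
      by (intro uniform_limitD[OF p]) simp
    then obtain N where N: "\<And>k x. k \<ge> N \<Longrightarrow> x \<in> X \<Longrightarrow> dist (poly (p k) (of_real x)) (g x) < e / 4"
      unfolding eventually_sequentially by blast
    have "dist (L k) (L m) < e" if "k \<ge> N" "m \<ge> N" for k m
    proof -
      have "onorm (\<lambda>u. poly_op (p k) A u - poly_op (p m) A u) \<le> e / 2"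
      proof (rule onorm_poly_op_diff_le)
        fix x assume x: "x \<in> X"
        show "norm (poly (p k) (of_real x) - poly (p m) (of_real x)) \<le> e / 2"
          using dist_triangle2[of "poly (p k) (of_real x)" "poly (p m) (of_real x)" "g x"]
            N[OF that(1) x] N[OF that(2) x] by (simp add: dist_norm)
      qed
      then show ?thesis
        using \<open>0 < e\<close> by (simp add: dist_norm norm_blinfun.rep_eq minus_blinfun.rep_eq L)
    qed
    then show "\<exists>M. \<forall>m\<ge>M. \<forall>n\<ge>M. dist (L m) (L n) < e"
      by blast
  qed
  then obtain l where l: "L \<longlonglongrightarrow> l"
    using Cauchy_convergent convergent_def by blast
  define B where "B = blinfun_apply l"
  have B_lim: "(\<lambda>k. poly_op (p k) A u) \<longlonglongrightarrow> B u" for u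
    using blinfun.tendsto[OF l tendsto_const[of u]] by (simp add: L B_def)
  \<comment> \<open>That type records real linearity only; complex homogeneity is recovered from the
    pointwise limits.\<close>
  have B: "bounded_clinear B"
  proof (rule bounded_clinearI)
    show "bounded_linear B"
      by (simp add: B_def blinfun.bounded_linear_right)
    fix c u
    have "(\<lambda>k. scaleC c (poly_op (p k) A u)) \<longlonglongrightarrow> scaleC c (B u)"
      by (rule bounded_linear.tendsto[OF bounded_linear_scaleC B_lim])
    then have "(\<lambda>k. poly_op (p k) A (scaleC c u)) \<longlonglongrightarrow> scaleC c (B u)"
      by (simp add: bounded_clinear_scaleC[OF bounded_clinear_poly_op[OF clinear_A]])
    then show "B (scaleC c u) = scaleC c (B u)"
      using B_lim LIMSEQ_unique by blast
  qed
  have p_B: "(\<lambda>k. onorm (\<lambda>u. poly_op (p k) A u - B u)) \<longlonglongrightarrow> 0"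
    using tendsto_norm_zero[OF LIM_zero[OF l]]
    by (simp add: norm_blinfun.rep_eq minus_blinfun.rep_eq L B_def)
  have "(\<lambda>k. onorm (\<lambda>u. poly_op (q k) A u - B u)) \<longlonglongrightarrow> 0"
    if q: "uniform_limit X (\<lambda>k x. poly (q k) (of_real x)) g sequentially" for q
  proof (rule LIMSEQ_I)
    fix e :: real assume "0 < e"
    then have "\<forall>\<^sub>F k in sequentially. \<forall>x\<in>X. dist (poly (p k) (of_real x)) (g x) < e / 4"
      "\<forall>\<^sub>F k in sequentially. \<forall>x\<in>X. dist (poly (q k) (of_real x)) (g x) < e / 4"
      "\<forall>\<^sub>F k in sequentially. dist (onorm (\<lambda>u. poly_op (p k) A u - B u)) 0 < e / 2"
      by (intro uniform_limitD[OF p] uniform_limitD[OF q] tendstoD[OF p_B]; simp)+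
    then have "\<forall>\<^sub>F k in sequentially. norm (onorm (\<lambda>u. poly_op (q k) A u - B u) - 0) < e"
    proof eventually_elim
      case (elim k)
      have "onorm (\<lambda>u. poly_op (q k) A u - poly_op (p k) A u) \<le> e / 2"
      proof (rule onorm_poly_op_diff_le)
        fix x assume x: "x \<in> X"
        show "norm (poly (q k) (of_real x) - poly (p k) (of_real x)) \<le> e / 2"
          using elim(1,2) x
            dist_triangle2[of "poly (q k) (of_real x)" "poly (p k) (of_real x)" "g x"]
          by (fastforce simp: dist_norm)
      qed
      moreover have "onorm (\<lambda>u. poly_op (q k) A u - B u)
          \<le> onorm (\<lambda>u. poly_op (q k) A u - poly_op (p k) A u) + onorm (\<lambda>u. poly_op (p k) A u - B u)"
        using onorm_triangle[of "\<lambda>u. poly_op (q k) A u - poly_op (p k) A u" "\<lambda>u. poly_op (p k) A u - B u"]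
        by (simp add: bounded_linear_sub poly_op_linear_op bounded_clinear_linear[OF B])
      moreover have "0 \<le> onorm (\<lambda>u. poly_op (q k) A u - B u)"
        by (intro onorm_pos_le bounded_linear_sub poly_op_linear_op bounded_clinear_linear[OF B])
      ultimately show ?case
        using elim(3) by simp
    qed
    then show "\<exists>N. \<forall>k\<ge>N. norm (onorm (\<lambda>u. poly_op (q k) A u - B u) - 0) < e"
      by (simp add: eventually_sequentially)
  qed
  with B show ?thesis
    by blast
qed

text \<open>The supplied sequence makes the definite description determinate: any candidate must be
  its pointwise limit.\<close>

lemma
  assumes p: "uniform_limit X (\<lambda>k x. poly (p k) (of_real x)) g sequentially"
  shows bounded_clinear_cont_calculus: "bounded_clinear (cont_calculus g A)"
    and onorm_cont_calculus_tendsto: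
      "(\<lambda>k. onorm (\<lambda>u. poly_op (p k) A u - cont_calculus g A u)) \<longlonglongrightarrow> 0"
    and cont_calculus_tendsto: "(\<lambda>k. poly_op (p k) A u) \<longlonglongrightarrow> cont_calculus g A u"
proof -
  let ?P = "\<lambda>B. bounded_clinear B \<and> (\<forall>p. uniform_limit X (\<lambda>k x. poly (p k) (of_real x)) g sequentially
        \<longrightarrow> (\<lambda>k. onorm (\<lambda>u. poly_op (p k) A u - B u)) \<longlonglongrightarrow> 0)"
  have lim: "(\<lambda>k. poly_op (p k) A u) \<longlonglongrightarrow> B u" if "?P B" for B u
    by (rule tendsto_of_onorm_tendsto_0) (use bounded_clinear_poly_op[OF clinear_A] that p in auto)
  have "\<exists>!B. ?P B"
    using cont_calculus_exists[OF p] lim by (blast intro: LIMSEQ_unique)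
  then have *: "?P (cont_calculus g A)"
    unfolding cont_calculus_def by (rule theI')
  then show "bounded_clinear (cont_calculus g A)"
    "(\<lambda>k. onorm (\<lambda>u. poly_op (p k) A u - cont_calculus g A u)) \<longlonglongrightarrow> 0"
    using p by auto
  show "(\<lambda>k. poly_op (p k) A u) \<longlonglongrightarrow> cont_calculus g A u"
    by (rule lim[OF *])
qed

text \<open>The constant zero polynomial already approximates such a \<open>g\<close> on the
  spectrum.\<close>

lemma cont_calculus_eq_0:
  assumes "\<And>x. x \<in> X \<Longrightarrow> g x = 0"
  shows "cont_calculus g A u = 0"
proof -
  have "uniform_limit X (\<lambda>k x. poly 0 (of_real x)) g sequentially"
    using assms by (simp add: uniform_limit_iff)
  from cont_calculus_tendsto[OF this, of u] show ?thesis
    by (simp add: LIMSEQ_const_iff)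
qed

end

section \<open>Discrete Schroedinger operators and their covariance\<close>

lift_definition translate :: "int \<Rightarrow> int ell2 \<Rightarrow> int ell2" is "\<lambda>m u n. u (n + m)"
  subgoal for m u
    using summable_on_reindex_bij_betw[of "\<lambda>n. n + m" UNIV UNIV "\<lambda>n. (norm (u n))\<^sup>2"]
    by (simp add: bij_plus_right)
  done

lemma coord_translate [simp]: "coord (translate m u) n = coord u (n + m)"
  by transfer simp

lemma inner_translate: "inner (translate m u) v = inner u (translate (- m) v)"
proof -
  have "inner (translate m u) v = (\<Sum>\<^sub>\<infinity>n. inner (coord u (n + m)) (coord v (n + m - m)))"
    by (simp add: inner_ell2_eq)
  also have "\<dots> = (\<Sum>\<^sub>\<infinity>n. inner (coord u n) (coord v (n - m)))"
    by (rule infsum_reindex_bij_betw[of "\<lambda>n. n + m" UNIV UNIV]) (simp add: bij_plus_right)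
  finally show ?thesis
    by (simp add: inner_ell2_eq)
qed

lemma translate_translate [simp]: "translate m (translate n u) = translate (m + n) u"
  by (rule ell2_eqI) (simp add: algebra_simps)

lemma translate_0 [simp]: "translate 0 u = u"
  by (rule ell2_eqI) simp

lemma norm_translate [simp]: "norm (translate m u) = norm u"
  unfolding norm_eq_sqrt_inner inner_translate by simp

lemma translate_add: "translate m (u + v) = translate m u + translate m v"
  and translate_scaleC: "translate m (scaleC c u) = scaleC c (translate m u)"
  and translate_zero: "translate m 0 = 0"
  by (rule ell2_eqI; simp)+

lemma translate_delta: "translate m (delta n) = delta (n - m)"
  by (rule ell2_eqI) (auto simp: coord_delta)

context
  fixes V :: "int \<Rightarrow> real" and C :: real
  assumes V: "\<And>n. \<bar>V n\<bar> \<le> C"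
begin

lemma norm_schrodinger_le: "norm (schrodinger V u) \<le> (2 + C) * norm u"
proof -
  \<comment> \<open>\<open>w\<close> is the diagonal part of the operator; the other two summands
    are isometric shifts.\<close>
  define w where "w = schrodinger V u - translate 1 u - translate (-1) u"
  have "0 \<le> C"
    using V[of 0] by simp
  have w: "coord w n = complex_of_real (V n) * coord u n" for n
    by (simp add: w_def coord_schrodinger[OF V])
  have "(norm w)\<^sup>2 \<le> (\<Sum>\<^sub>\<infinity>n. C\<^sup>2 * (norm (coord u n))\<^sup>2)"
    unfolding norm_ell2_square
  proof (rule infsum_mono[OF summable_coord summable_on_cmult_right[OF summable_coord]])
    fix n
    have "\<bar>V n\<bar>\<^sup>2 \<le> C\<^sup>2"
      using V by (intro power_mono) auto
    then show "(norm (coord w n))\<^sup>2 \<le> C\<^sup>2 * (norm (coord u n))\<^sup>2"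
      by (simp add: w norm_mult power_mult_distrib mult_right_mono)
  qed
  also have "\<dots> = (C * norm u)\<^sup>2"
    by (simp add: infsum_cmult_right' norm_ell2_square power_mult_distrib)
  finally have "norm w \<le> C * norm u"
    by (rule power2_le_imp_le) (use \<open>0 \<le> C\<close> in simp)
  moreover have "schrodinger V u = w + translate 1 u + translate (-1) u"
    by (simp add: w_def)
  then have "norm (schrodinger V u) \<le> norm w + norm (translate 1 u) + norm (translate (-1) u)"
    using norm_triangle_ineq[of "w + translate 1 u" "translate (-1) u"]
      norm_triangle_ineq[of w "translate 1 u"] by simp
  ultimately show ?thesis
    by (simp add: algebra_simps)
qed

lemma bounded_clinear_schrodinger: "bounded_clinear (schrodinger V)"
proof (rule bounded_clinearI)
  show "bounded_linear (schrodinger V)"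
  proof (rule bounded_linear_intro[where K="2 + C"])
    show "schrodinger V (u + v) = schrodinger V u + schrodinger V v" for u v
      by (rule ell2_eqI) (simp add: coord_schrodinger[OF V] algebra_simps)
    show "schrodinger V (r *\<^sub>R u) = r *\<^sub>R schrodinger V u" for r u
      by (rule ell2_eqI) (simp add: coord_schrodinger[OF V] scaleR_conv_of_real algebra_simps)
    show "norm (schrodinger V u) \<le> norm u * (2 + C)" for u
      using norm_schrodinger_le by (simp add: mult.commute)
  qed
  show "schrodinger V (scaleC c u) = scaleC c (schrodinger V u)" for c u
    by (rule ell2_eqI) (simp add: coord_schrodinger[OF V] algebra_simps)
qed

text \<open>The two shifts are adjoint to each other, and the diagonal part is multiplication by a
  real sequence.\<close>

lemma self_adjoint_schrodinger: "self_adjoint (schrodinger V)"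
  unfolding self_adjoint_def
proof (intro conjI allI bounded_clinear_schrodinger)
  fix u v
  define W where "W = (\<lambda>u. schrodinger V u - translate 1 u - translate (-1) u)"
  have W: "coord (W u) n = complex_of_real (V n) * coord u n" for u n
    by (simp add: W_def coord_schrodinger[OF V])
  have "inner (W u) v = inner u (W v)"
    unfolding inner_ell2_eq by (rule infsum_cong) (simp add: W inner_complex_def)
  moreover have "schrodinger V u = W u + translate 1 u + translate (-1) u" for u
    by (simp add: W_def)
  ultimately show "inner (schrodinger V u) v = inner u (schrodinger V v)"
    by (simp add: inner_add_left inner_add_right inner_translate)
qed

lemma abs_le_if_in_spectrum_schrodinger:
  assumes "complex_of_real x \<in> spectrum (schrodinger V)"
  shows "\<bar>x\<bar> \<le> 2 + C"
proof -
  have "onorm (schrodinger V) \<le> 2 + C"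
    by (rule onorm_bound) (use V[of 0] norm_schrodinger_le in auto)
  then show ?thesis
    using norm_spectrum_le[OF bounded_clinear_schrodinger assms] by simp
qed

lemma translate_schrodinger:
  "translate m (schrodinger V u) = schrodinger (\<lambda>n. V (n + m)) (translate m u)"
  by (rule ell2_eqI)
    (simp add: coord_schrodinger[of V, OF V] coord_schrodinger[of "\<lambda>n. V (n + m)", OF V] algebra_simps)

end

lemma translate_poly_op_schrodinger:
  assumes V: "\<And>n. \<bar>V n\<bar> \<le> C"
  shows "translate m (poly_op p (schrodinger V) u)
    = poly_op p (schrodinger (\<lambda>n. V (n + m))) (translate m u)"
  by (induction p)
    (simp_all add: poly_op_pCons[OF bounded_clinear_schrodinger, of _ C] V translate_zero
      translate_add translate_scaleC translate_schrodinger[of _ C])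

section \<open>Integer iterates of an invertible measure-preserving map\<close>

locale transformation =
  fixes M :: "'a measure" and T :: "'a \<Rightarrow> 'a"
  assumes invertible: "invertible_transformation M T"
    and preserving: "measure_preserving M T"
begin

abbreviation "Tinv \<equiv> inv_into (space M) T"
abbreviation "I \<equiv> int_iterate M T"

lemma T_measurable [measurable]: "T \<in> M \<rightarrow>\<^sub>M M"
  and Tinv_measurable [measurable]: "Tinv \<in> M \<rightarrow>\<^sub>M M"
  and T_bij: "bij_betw T (space M) (space M)"
  using invertible by (auto simp: invertible_transformation_def)

lemma T_Tinv: "\<omega> \<in> space M \<Longrightarrow> T (Tinv \<omega>) = \<omega>"
  and Tinv_T: "\<omega> \<in> space M \<Longrightarrow> Tinv (T \<omega>) = \<omega>"
  using T_bij by (auto intro: bij_betw_inv_into_right bij_betw_inv_into_left)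

lemma funpow_measurable:
  assumes [measurable]: "S \<in> M \<rightarrow>\<^sub>M M"
  shows "S ^^ n \<in> M \<rightarrow>\<^sub>M M"
  by (induction n) (auto simp: id_def[symmetric] intro: measurable_comp)

lemma int_iterate_measurable [measurable]: "I n \<in> M \<rightarrow>\<^sub>M M"
  by (simp add: int_iterate_def funpow_measurable)

lemma int_iterate_space: "\<omega> \<in> space M \<Longrightarrow> I n \<omega> \<in> space M"
  by (rule measurable_space[OF int_iterate_measurable])

lemma int_iterate_0: "I 0 \<omega> = \<omega>"
  by (simp add: int_iterate_def)

lemma int_iterate_succ:
  assumes "\<omega> \<in> space M"
  shows "I (n + 1) \<omega> = T (I n \<omega>)"
proof (cases "0 \<le> n")
  case True
  then show ?thesis
    by (simp add: int_iterate_def nat_add_distrib)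
next
  case False
  then have "I n \<omega> = Tinv (I (n + 1) \<omega>)"
    \<comment> \<open>For \<open>n = -1\<close> the successor index is \<open>0\<close>, where
      \<open>int_iterate\<close> switches to powers of \<open>T\<close>.\<close>
    by (cases "n = -1") (auto simp: int_iterate_def Suc_nat_eq_nat_zadd1 simp flip: funpow.simps(2)[THEN fun_cong, unfolded comp_def])
  then show ?thesis
    using T_Tinv[OF int_iterate_space[OF assms]] by simp
qed

lemma int_iterate_pred:
  assumes "\<omega> \<in> space M"
  shows "I (n - 1) \<omega> = Tinv (I n \<omega>)"
  using int_iterate_succ[OF assms, of "n - 1"] Tinv_T[OF int_iterate_space[OF assms]] by simp

lemma int_iterate_add:
  assumes "\<omega> \<in> space M"
  shows "I (n + m) \<omega> = I n (I m \<omega>)"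
proof (induction n rule: int_induct[where k=0])
  case base
  show ?case by (simp add: int_iterate_0)
next
  case (step1 i)
  then show ?case
    using int_iterate_succ[OF assms, of "i + m"] int_iterate_succ[OF int_iterate_space[OF assms], of i m]
    by (simp add: algebra_simps)
next
  case (step2 i)
  then show ?case
    using int_iterate_pred[OF assms, of "i + m"] int_iterate_pred[OF int_iterate_space[OF assms], of i m]
    by (simp add: algebra_simps)
qed

lemma distr_T: "distr M M T = M"
  by (rule measure_eqI) (use preserving in \<open>auto simp: emeasure_distr measure_preserving_def\<close>)

lemma distr_Tinv: "distr M M Tinv = M"
proof -
  have "distr M M Tinv = distr (distr M M T) M Tinv"
    by (simp add: distr_T)
  also have "\<dots> = distr M M (Tinv \<circ> T)"
    by (rule distr_distr) measurable
  also have "\<dots> = distr M M (\<lambda>\<omega>. \<omega>)"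
    by (rule distr_cong) (simp_all add: Tinv_T)
  finally show ?thesis
    by simp
qed

lemma distr_funpow:
  assumes [measurable]: "S \<in> M \<rightarrow>\<^sub>M M" and "distr M M S = M"
  shows "distr M M (S ^^ n) = M"
proof (induction n)
  case (Suc n)
  have "distr M M (S ^^ Suc n) = distr (distr M M (S ^^ n)) M S"
    by (subst distr_distr) (simp_all add: funpow_measurable)
  then show ?case
    unfolding Suc assms(2) .
qed (simp add: id_def)

text \<open>All iterates, forward and backward, preserve the measure, so null sets pull back to null
  sets.\<close>

lemma AE_int_iterate:
  assumes "AE \<omega> in M. P \<omega>"
  shows "AE \<omega> in M. P (I n \<omega>)"
proof (rule AE_distrD[OF int_iterate_measurable])
  have "distr M M (I n) = M"
    by (simp add: int_iterate_def distr_funpow distr_T distr_Tinv)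
  then show "AE \<omega> in distr M M (I n). P \<omega>"
    using assms by metis
qed

end

section \<open>Measurability and covariance of the operators along an orbit\<close>

locale dynamical_schrodinger = transformation +
  fixes f :: "'a \<Rightarrow> real" and C :: real
  assumes f_measurable [measurable]: "f \<in> borel_measurable M"
    and f_bounded: "\<And>\<omega>. \<omega> \<in> space M \<Longrightarrow> \<bar>f \<omega>\<bar> \<le> C"
begin

abbreviation "H \<equiv> ham M T f"

lemma potential_bounded: "\<omega> \<in> space M \<Longrightarrow> \<bar>f (I n \<omega>)\<bar> \<le> C"
  by (rule f_bounded[OF int_iterate_space])

lemma self_adjoint_ham: "\<omega> \<in> space M \<Longrightarrow> self_adjoint (H \<omega>)"
  unfolding ham_def by (rule self_adjoint_schrodinger[of "\<lambda>n. f (I n \<omega>)" C, OF potential_bounded])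

lemma spectrum_ham_subset:
  assumes "\<omega> \<in> space M" and "complex_of_real x \<in> spectrum (H \<omega>)"
  shows "x \<in> {- (2 + C)..2 + C}"
  using abs_le_if_in_spectrum_schrodinger[of "\<lambda>n. f (I n \<omega>)" C, OF potential_bounded[OF assms(1)]]
    assms(2) by (fastforce simp: ham_def)

text \<open>The induction treats all coordinates together, since each application of the operator
  involves both neighbours.\<close>

lemma coord_poly_op_ham_measurable [measurable]:
  "(\<lambda>\<omega>. coord (poly_op p (H \<omega>) u) n) \<in> borel_measurable M"
proof (induction p arbitrary: n)
  case (pCons a p)
  note [measurable] = pCons(2)
  have "coord (poly_op (pCons a p) (H \<omega>) u) n = a * coord u n
      + (coord (poly_op p (H \<omega>) u) (n - 1) + coord (poly_op p (H \<omega>) u) (n + 1)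
         + complex_of_real (f (I n \<omega>)) * coord (poly_op p (H \<omega>) u) n)"
    if "\<omega> \<in> space M" for \<omega>
    using self_adjoint_bounded_clinear[OF self_adjoint_ham[OF that]] potential_bounded[OF that]
    by (simp add: poly_op_pCons) (simp add: ham_def coord_schrodinger[of _ C])
  then show ?case
    by (subst measurable_cong) (assumption, measurable)
qed simp

text \<open>Covariance: translation by \<open>n\<close> conjugates the operator at \<omega> into the
  one at \<open>I n \<omega>\<close>, sends \<open>delta n\<close> to \<open>delta 0\<close>, and is
  isometric.\<close>

lemma norm_poly_op_ham_delta:
  assumes \<omega>: "\<omega> \<in> space M"
  shows "norm (poly_op p (H \<omega>) (delta n)) = norm (poly_op p (H (I n \<omega>)) (delta 0))"
proof -
  have "H (I n \<omega>) = schrodinger (\<lambda>k. f (I (k + n) \<omega>))"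
    by (simp add: ham_def int_iterate_add[OF \<omega>])
  then have "poly_op p (H (I n \<omega>)) (delta 0) = translate n (poly_op p (H \<omega>) (delta n))"
    using translate_poly_op_schrodinger[of "\<lambda>n. f (I n \<omega>)" C, OF potential_bounded[OF \<omega>]]
    by (simp add: ham_def translate_delta)
  then show ?thesis
    by simp
qed

end

section \<open>Null balls of the local densities of states\<close>

text \<open>The tent function. For positive \<open>e\<close> it is nonzero exactly on the open ball,
  so the integral of its square detects whether the ball is null.\<close>

definition bump :: "real \<Rightarrow> real \<Rightarrow> real \<Rightarrow> real" where
  "bump c e x = max 0 (1 - \<bar>x - c\<bar> / e)"

lemma bump_center [simp]: "bump c e c = 1"
  by (simp add: bump_def)

lemma bump_nonneg: "0 \<le> bump c e x"
  by (simp add: bump_def)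

lemma bump_le_1: "0 < e \<Longrightarrow> bump c e x \<le> 1"
  by (simp add: bump_def)

lemma bump_eq_0_iff: "0 < e \<Longrightarrow> bump c e x = 0 \<longleftrightarrow> x \<notin> ball c e"
  by (auto simp: bump_def dist_real_def abs_minus_commute max_def field_simps)

lemma continuous_on_bump: "0 < e \<Longrightarrow> continuous_on UNIV (bump c e)"
  unfolding bump_def by (intro continuous_intros) auto

lemma borel_measurable_bump: "0 < e \<Longrightarrow> bump c e \<in> borel_measurable borel"
  by (intro borel_measurable_continuous_onI continuous_on_bump)

lemma compact_closure_bump_square:
  assumes "0 < e"
  shows "compact (closure {x. complex_of_real ((bump c e x)\<^sup>2) \<noteq> 0})"
proof -
  have "{x. complex_of_real ((bump c e x)\<^sup>2) \<noteq> 0} \<subseteq> ball c e"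
    using assms by (auto simp: bump_eq_0_iff)
  then show ?thesis
    by (meson bounded_ball bounded_subset compact_closure)
qed

lemma integral_bump_square_eq_0_iff:
  assumes "prob_space N" and N: "sets N = sets borel" and e: "0 < e"
  shows "(LINT x|N. complex_of_real ((bump c e x)\<^sup>2)) = 0 \<longleftrightarrow> emeasure N (ball c e) = 0"
proof -
  interpret prob_space N by fact
  have [measurable]: "bump c e \<in> borel_measurable N"
    using borel_measurable_bump[OF e] N by (simp cong: measurable_cong_sets)
  have "integrable N (\<lambda>x. (bump c e x)\<^sup>2)"
    by (rule integrable_const_bound[where B=1])
      (use bump_le_1[OF e] bump_nonneg in \<open>auto simp: power_le_one\<close>)
  then have "(LINT x|N. (bump c e x)\<^sup>2) = 0 \<longleftrightarrow> (AE x in N. (bump c e x)\<^sup>2 = 0)"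
    by (rule integral_nonneg_eq_0_iff_AE) simp
  also have "\<dots> \<longleftrightarrow> (AE x in N. x \<notin> ball c e)"
    by (simp add: bump_eq_0_iff[OF e])
  also have "\<dots> \<longleftrightarrow> ball c e \<in> null_sets N"
    by (rule AE_iff_null_sets[symmetric]) (simp add: N)
  finally show ?thesis
    by (simp add: null_sets_def N del: of_real_power)
qed

text \<open>Every point of \<open>U\<close> lies in an open null set; by the Lindelof property
  countably many of these cover \<open>U\<close>.\<close>

lemma emeasure_eq_0_if_disjoint_topological_support:
  fixes N :: "'a::second_countable_topology measure"
  assumes N: "sets N = sets borel" and U: "open U" "U \<inter> topological_support N = {}"
  shows "emeasure N U = 0"
proof -
  define \<U> where "\<U> = {V. open V \<and> emeasure N V = 0}"
  obtain \<V> where \<V>: "\<V> \<subseteq> \<U>" "countable \<V>" "\<Union>\<V> = \<Union>\<U>"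
    by (rule Lindelof[of \<U>]) (simp_all add: \<U>_def)
  have "U \<subseteq> \<Union>\<V>"
  proof
    fix x assume "x \<in> U"
    then have "x \<notin> topological_support N"
      using U(2) by blast
    then obtain V where "open V" "x \<in> V" "\<not> 0 < emeasure N V"
      unfolding topological_support_def by blast
    then have "V \<in> \<U>"
      by (simp add: \<U>_def)
    with \<open>x \<in> V\<close> show "x \<in> \<Union>\<V>"
      unfolding \<V>(3) by blast
  qed
  moreover have "(\<Union>V\<in>\<V>. V) \<in> null_sets N"
    by (rule null_sets_UN') (use \<V>(1,2) in \<open>auto simp: \<U>_def null_sets_def N\<close>)
  moreover have "U \<in> sets N"
    by (simp add: N U(1))
  ultimately have "U \<in> null_sets N"
    using null_sets_subset[of "\<Union>\<V>" N U] by simp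
  then show ?thesis
    by (rule null_setsD1)
qed

text \<open>Exhaust the space by countably many sets of finite measure. Each is either null or
  admissible as \<open>F\<close>, and on the latter a nonnegative function with zero integral
  vanishes almost everywhere.\<close>

lemma (in sigma_finite_measure) AE_eq_0_if_set_integrals_eq_0:
  fixes \<psi> :: "'a \<Rightarrow> real"
  assumes [measurable]: "\<psi> \<in> borel_measurable M"
    and bounds: "\<And>\<omega>. \<omega> \<in> space M \<Longrightarrow> 0 \<le> \<psi> \<omega> \<and> \<psi> \<omega> \<le> K"
    and int0: "\<And>F. F \<in> finite_positive_sets M \<Longrightarrow> (LINT \<omega>:F|M. \<psi> \<omega>) = 0"
  shows "AE \<omega> in M. \<psi> \<omega> = 0"
proof -
  obtain A :: "nat \<Rightarrow> 'a set" where A: "range A \<subseteq> sets M" "(\<Union>i. A i) = space M"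
      "\<And>i. emeasure M (A i) \<noteq> \<infinity>"
    using sigma_finite by blast
  have [measurable]: "A i \<in> sets M" for i
    using A(1) by auto
  have "AE \<omega> in M. \<omega> \<in> A i \<longrightarrow> \<psi> \<omega> = 0" for i
  proof (cases "emeasure M (A i) = 0")
    case True
    then have "AE \<omega> in M. \<omega> \<notin> A i"
      by (intro AE_not_in) (auto simp: null_sets_def)
    then show ?thesis
      by eventually_elim simp
  next
    case False
    then have "A i \<in> finite_positive_sets M"
      using A(3)[of i] by (auto simp: finite_positive_sets_def zero_less_iff_neq_zero less_top)
    then have 0: "(LINT \<omega>|M. indicator (A i) \<omega> *\<^sub>R \<psi> \<omega>) = 0"
      using int0 by (simp add: set_lebesgue_integral_def)
    have "integrable M (\<lambda>\<omega>. indicator (A i) \<omega> *\<^sub>R \<psi> \<omega>)"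
      by (rule integrableI_bounded_set_indicator[where B=K])
        (use A(3)[of i] bounds in \<open>auto simp: less_top\<close>)
    moreover have "AE \<omega> in M. 0 \<le> indicator (A i) \<omega> *\<^sub>R \<psi> \<omega>"
      using bounds by (auto intro!: AE_I2)
    ultimately have "AE \<omega> in M. indicator (A i) \<omega> *\<^sub>R \<psi> \<omega> = 0"
      using 0 integral_nonneg_eq_0_iff_AE by blast
    then show ?thesis
      by eventually_elim (simp split: split_indicator_asm)
  qed
  then have "AE \<omega> in M. \<forall>i. \<omega> \<in> A i \<longrightarrow> \<psi> \<omega> = 0"
    unfolding AE_all_countable by blast
  moreover have "AE \<omega> in M. \<omega> \<in> space M"
    by (rule AE_space)
  ultimately show ?thesis
  proof eventually_elim
    case (elim \<omega>)
    then show ?case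
      using A(2) by auto
  qed
qed

lemma bounded_linear_coord: "bounded_linear (\<lambda>u. coord u n)"
  by (rule bounded_linear_intro[where K=1]) (use norm_coord_le in auto)

text \<open>Moving one factor \<open>p(A)\<close> across the inner product produces a squared norm.
  Testing with a free scalar, at \<open>1\<close> and \<open>- \<i>\<close>, extracts both parts of
  the coordinate from real inner products.\<close>

lemma coord_poly_op_square_delta:
  assumes sa: "self_adjoint A" and p: "map_poly cnj p = p"
  shows "coord (poly_op (p * p) A (delta n)) n = complex_of_real ((norm (poly_op p A (delta n)))\<^sup>2)"
proof -
  let ?w = "poly_op p A (delta n)"
  note A = self_adjoint_bounded_clinear[OF sa]
  have "Re (c * coord (poly_op (p * p) A (delta n)) n) = Re c * (norm ?w)\<^sup>2" for c
  proof -
    have "Re (c * coord (poly_op (p * p) A (delta n)) n)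
        = inner (delta n) (poly_op p A (scaleC c ?w))"
      by (simp add: inner_delta_left poly_op_mult[OF A] bounded_clinear_scaleC[OF bounded_clinear_poly_op[OF A]])
    also have "\<dots> = inner ?w (scaleC c ?w)"
      using inner_poly_op_adjoint[OF sa, of p "delta n"] p by simp
    finally show ?thesis
      by (simp add: inner_scaleC_self)
  qed
  from this[of 1] this[of "- \<i>"] show ?thesis
    by (simp add: complex_eq_iff)
qed

text \<open>The coordinates of \<open>B u\<close> are pairings of \<open>u\<close> with the vectors
  \<open>B (delta n)\<close>; the scalars \<open>1\<close> and \<open>- \<i>\<close> again separate
  real and imaginary parts.\<close>

lemma eq_0_if_self_adjoint_delta:
  assumes sa: "self_adjoint B" and 0: "\<And>n. B (delta n) = 0"
  shows "B u = 0"
proof (rule ell2_eqI)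
  fix n
  note B = self_adjoint_bounded_clinear[OF sa]
  have "Re (c * coord (B u) n) = 0" for c
  proof -
    have "Re (c * coord (B u) n) = inner (delta n) (B (scaleC c u))"
      by (simp add: inner_delta_left bounded_clinear_scaleC[OF B])
    also have "\<dots> = 0"
      by (simp add: 0 flip: self_adjoint_inner[OF sa])
    finally show ?thesis .
  qed
  from this[of 1] this[of "- \<i>"] show "coord (B u) n = coord 0 n"
    by (simp add: complex_eq_iff)
qed

section \<open>Matrix elements of squared bumps\<close>

context dynamical_schrodinger
begin

text \<open>The bump enters squared so that this matrix element is the squared norm of the bump of
  the operator applied to \<open>delta 0\<close>.\<close>

definition bump_density :: "real \<Rightarrow> real \<Rightarrow> 'a \<Rightarrow> complex" where
  "bump_density c e \<omega> =
    cinner (delta 0) (cont_calculus (\<lambda>x. of_real ((bump c e x)\<^sup>2)) (H \<omega>) (delta 0))"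

text \<open>Approximating on one interval that contains the spectra for all \<open>\<omega>\<close>, rather than on the almost
  sure spectrum, makes the matrix elements measurable even if \<open>M\<close> is not complete.\<close>
lemma bump_approximation:
  assumes e: "0 < e"
  obtains P :: "nat \<Rightarrow> complex poly" where
    "\<And>k. map_poly cnj (P k) = P k"
    "uniform_limit {- (2 + C)..2 + C} (\<lambda>k x. poly (P k) (of_real x)) (\<lambda>x. of_real (bump c e x)) sequentially"
    "\<And>k x. x \<in> {- (2 + C)..2 + C} \<Longrightarrow> norm (poly (P k) (of_real x)) \<le> 2"
proof -
  obtain p :: "nat \<Rightarrow> real poly" where
    p: "\<And>k x. x \<in> {- (2 + C)..2 + C} \<Longrightarrow> \<bar>bump c e x - poly (p k) x\<bar> < inverse (real (Suc k))"
    using uniform_polynomial_approximation[OF continuous_on_bump[OF e, of c], of "2 + C"] by blast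
  show thesis
  proof (rule that[of "\<lambda>k. map_poly of_real (p k)"])
    show "uniform_limit {- (2 + C)..2 + C} (\<lambda>k x. poly (map_poly of_real (p k)) (complex_of_real x))
        (\<lambda>x. of_real (bump c e x)) sequentially"
      unfolding poly_map_of_real
      by (intro uniform_limit_of_real uniform_limit_polynomial_approximation p)
    fix k x assume x: "x \<in> {- (2 + C)..2 + C}"
    have "inverse (real (Suc k)) \<le> 1"
      by (simp add: inverse_eq_divide)
    then show "norm (poly (map_poly of_real (p k)) (complex_of_real x)) \<le> 2"
      using p[OF x, of k] bump_nonneg[of c e x] bump_le_1[OF e, of c x]
      unfolding poly_map_of_real by (auto simp: abs_le_iff)
  qed simp
qed

context
  fixes P :: "nat \<Rightarrow> complex poly" and c e :: real
  assumes e: "0 < e"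
    and P_real: "\<And>k. map_poly cnj (P k) = P k"
    and P_lim: "uniform_limit {- (2 + C)..2 + C} (\<lambda>k x. poly (P k) (of_real x))
      (\<lambda>x. of_real (bump c e x)) sequentially"
    and P_le: "\<And>k x. x \<in> {- (2 + C)..2 + C} \<Longrightarrow> norm (poly (P k) (of_real x)) \<le> 2"
begin

private abbreviation "\<phi> \<equiv> bump_density c e"

lemma uniform_limit_spectrum:
  assumes "\<omega> \<in> space M"
  shows "uniform_limit {x. complex_of_real x \<in> spectrum (H \<omega>)} (\<lambda>k x. poly (P k) (of_real x))
      (\<lambda>x. of_real (bump c e x)) sequentially"
  by (rule uniform_limit_on_subset[OF P_lim]) (use spectrum_ham_subset[OF assms] in auto)

lemma coord_tendsto_phi:
  assumes \<omega>: "\<omega> \<in> space M"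
  shows "(\<lambda>k. coord (poly_op (P k * P k) (H \<omega>) (delta 0)) 0) \<longlonglongrightarrow> \<phi> \<omega>"
proof -
  \<comment> \<open>The product rule for uniform limits asks for bounded limit functions.\<close>
  have "bounded ((\<lambda>x. complex_of_real (bump c e x)) ` X)" for X
    by (rule boundedI[where B=1]) (use bump_nonneg bump_le_1[OF e] in auto)
  from uniform_lim_mult[OF uniform_limit_spectrum[OF \<omega>] uniform_limit_spectrum[OF \<omega>] this this]
  have "uniform_limit {x. complex_of_real x \<in> spectrum (H \<omega>)} (\<lambda>k x. poly (P k * P k) (of_real x))
      (\<lambda>x. of_real ((bump c e x)\<^sup>2)) sequentially"
    by (simp add: power2_eq_square)
  from bounded_linear.tendsto[OF bounded_linear_coord cont_calculus_tendsto[OF self_adjoint_ham[OF \<omega>] this]]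
  show ?thesis
    by (simp add: bump_density_def cinner_delta_left)
qed

lemma norm_square_tendsto_phi:
  assumes \<omega>: "\<omega> \<in> space M"
  shows "(\<lambda>k. complex_of_real ((norm (poly_op (P k) (H \<omega>) (delta 0)))\<^sup>2)) \<longlonglongrightarrow> \<phi> \<omega>"
  using coord_tendsto_phi[OF \<omega>]
  by (simp only: coord_poly_op_square_delta[OF self_adjoint_ham[OF \<omega>] P_real])

lemma phi_measurable: "\<phi> \<in> borel_measurable M"
  by (rule borel_measurable_LIMSEQ_metric[OF coord_poly_op_ham_measurable coord_tendsto_phi])

text \<open>The approximants are squared norms, and the bound \<open>2\<close> for
  \<open>P k\<close> on the spectrum gives the crude bound \<open>4\<close>, enough for
  integrability on sets of finite measure.\<close>

lemma phi_bounds: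
  assumes \<omega>: "\<omega> \<in> space M"
  shows "\<phi> \<omega> = of_real (Re (\<phi> \<omega>)) \<and> 0 \<le> Re (\<phi> \<omega>) \<and> Re (\<phi> \<omega>) \<le> 4"
proof (intro conjI)
  let ?N = "\<lambda>k. (norm (poly_op (P k) (H \<omega>) (delta 0)))\<^sup>2"
  note lim = norm_square_tendsto_phi[OF \<omega>]
  have Re: "?N \<longlonglongrightarrow> Re (\<phi> \<omega>)"
    using tendsto_Re[OF lim] by simp
  show "\<phi> \<omega> = of_real (Re (\<phi> \<omega>))"
    by (rule LIMSEQ_unique[OF lim tendsto_of_real[OF Re]])
  show "0 \<le> Re (\<phi> \<omega>)"
    by (rule LIMSEQ_le_const[OF Re]) auto
  have "?N k \<le> 4" for k
  proof -
    note sa = self_adjoint_ham[OF \<omega>]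
    have "onorm (poly_op (P k) (H \<omega>)) \<le> 2"
    proof (rule onorm_poly_op_le[OF sa])
      fix z assume z: "z \<in> spectrum (H \<omega>)"
      then have "z = of_real (Re z)"
        using spectrum_self_adjoint_real[OF sa z] by (simp add: complex_eq_iff)
      then show "norm (poly (P k) z) \<le> 2"
        using P_le[OF spectrum_ham_subset[OF \<omega>]] z by metis
    qed
    then have "norm (poly_op (P k) (H \<omega>) (delta 0)) \<le> 2"
      using bounded_clinear_onorm[OF bounded_clinear_poly_op[OF self_adjoint_bounded_clinear[OF sa]], of "P k" "delta 0"]
      by simp
    then show ?thesis
      using power_mono[of "norm (poly_op (P k) (H \<omega>) (delta 0))" 2 2] by simp
  qed
  then show "Re (\<phi> \<omega>) \<le> 4"
    by (intro LIMSEQ_le_const2[OF Re]) auto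
qed

text \<open>By covariance the hypothesis says that \<open>B\<close> kills every
  \<open>delta n\<close>, so \<open>B = 0\<close> and the norms of \<open>P k\<close> at the
  operator tend to \<open>0\<close>. If \<open>c\<close> were spectral, these norms would dominate
  \<open>norm (poly (P k) c)\<close>, which tends to \<open>1\<close>.\<close>

lemma bump_center_not_in_spectrum:
  assumes \<omega>: "\<omega> \<in> space M" and 0: "\<And>n. \<phi> (I n \<omega>) = 0"
  shows "complex_of_real c \<notin> spectrum (H \<omega>)"
proof
  assume c: "complex_of_real c \<in> spectrum (H \<omega>)"
  define B where "B = cont_calculus (\<lambda>x. complex_of_real (bump c e x)) (H \<omega>)"
  note sa = self_adjoint_ham[OF \<omega>]
  note lim = cont_calculus_tendsto[OF sa uniform_limit_spectrum[OF \<omega>], folded B_def]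
  have "B (delta n) = 0" for n
  proof -
    have "(\<lambda>k. (norm (poly_op (P k) (H (I n \<omega>)) (delta 0)))\<^sup>2) \<longlonglongrightarrow> 0"
      using tendsto_Re[OF norm_square_tendsto_phi[OF int_iterate_space[OF \<omega>]]] by (simp add: 0)
    moreover have "(\<lambda>k. (norm (poly_op (P k) (H \<omega>) (delta n)))\<^sup>2) \<longlonglongrightarrow> (norm (B (delta n)))\<^sup>2"
      by (intro tendsto_intros lim)
    ultimately show ?thesis
      using LIMSEQ_unique by (fastforce simp: norm_poly_op_ham_delta[OF \<omega>])
  qed
  moreover have "self_adjoint B"
    unfolding self_adjoint_def
  proof (intro conjI allI)
    show "bounded_clinear B"
      unfolding B_def by (rule bounded_clinear_cont_calculus[OF sa uniform_limit_spectrum[OF \<omega>]])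
    show "inner (B u) v = inner u (B v)" for u v
    proof (rule LIMSEQ_unique)
      show "(\<lambda>k. inner (poly_op (P k) (H \<omega>) u) v) \<longlonglongrightarrow> inner (B u) v"
        by (intro tendsto_intros lim)
      show "(\<lambda>k. inner (poly_op (P k) (H \<omega>) u) v) \<longlonglongrightarrow> inner u (B v)"
        unfolding inner_poly_op_adjoint[OF sa] P_real by (intro tendsto_intros lim)
    qed
  qed
  ultimately have "B u = 0" for u
    by (rule eq_0_if_self_adjoint_delta[rotated])
  then have "(\<lambda>k. onorm (poly_op (P k) (H \<omega>))) \<longlonglongrightarrow> 0"
    using onorm_cont_calculus_tendsto[OF sa uniform_limit_spectrum[OF \<omega>], folded B_def] by simp
  moreover have "(\<lambda>k. norm (poly (P k) (of_real c))) \<longlonglongrightarrow> 1"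
    using tendsto_norm[OF tendsto_uniform_limitI[OF uniform_limit_spectrum[OF \<omega>], of c]] c by simp
  moreover have "norm (poly (P k) (of_real c)) \<le> onorm (poly_op (P k) (H \<omega>))" for k
    by (rule norm_poly_spectrum_le[OF self_adjoint_bounded_clinear[OF sa] c])
  ultimately have "(1::real) \<le> 0"
    by (intro LIMSEQ_le[of _ 1 _ 0]) auto
  then show False
    by simp
qed

text \<open>Vanishing set integrals force the density to vanish almost everywhere. Intersecting over
  the countably many integer iterates gives vanishing along whole orbits.\<close>

lemma AE_bump_center_not_in_spectrum:
  assumes "sigma_finite_measure M"
    and "\<And>F. F \<in> finite_positive_sets M \<Longrightarrow> (LINT \<omega>:F|M. \<phi> \<omega>) = 0"
  shows "AE \<omega> in M. complex_of_real c \<notin> spectrum (H \<omega>)"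
proof -
  interpret sigma_finite_measure M by fact
  have [measurable]: "\<phi> \<in> borel_measurable M"
    by (rule phi_measurable)
  have "AE \<omega> in M. Re (\<phi> \<omega>) = 0"
  proof (rule AE_eq_0_if_set_integrals_eq_0[where K=4])
    fix F assume F: "F \<in> finite_positive_sets M"
    then have "F \<subseteq> space M" "F \<in> sets M"
      by (auto simp: finite_positive_sets_def sets.sets_into_space)
    then have "(LINT \<omega>:F|M. \<phi> \<omega>) = (LINT \<omega>:F|M. complex_of_real (Re (\<phi> \<omega>)))"
      using phi_bounds by (intro set_lebesgue_integral_cong) auto
    then show "(LINT \<omega>:F|M. Re (\<phi> \<omega>)) = 0"
      using assms(2)[OF F] by (simp add: set_integral_complex_of_real)
  qed (use phi_bounds in auto)
  then have "AE \<omega> in M. Re (\<phi> (I n \<omega>)) = 0" for n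
    by (rule AE_int_iterate)
  then have "AE \<omega> in M. \<forall>n. Re (\<phi> (I n \<omega>)) = 0"
    unfolding AE_all_countable by blast
  moreover have "AE \<omega> in M. \<omega> \<in> space M"
    by (rule AE_space)
  ultimately show ?thesis
  proof eventually_elim
    case (elim \<omega>)
    have "\<phi> (I n \<omega>) = 0" for n
      using phi_bounds[OF int_iterate_space[OF elim(2), of n]] elim(1) by simp
    then show ?case
      by (rule bump_center_not_in_spectrum[OF elim(2)])
  qed
qed

end

lemma density_of_states_ball_eq_0_iff:
  assumes F: "F \<in> finite_positive_sets M" and dos: "is_density_of_states M T f F N" and e: "0 < e"
  shows "emeasure N (ball c e) = 0 \<longleftrightarrow> (LINT \<omega>:F|M. bump_density c e \<omega>) = 0"
proof -
  have "measure M F \<noteq> 0"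
    using F by (auto simp: finite_positive_sets_def measure_def enn2real_eq_0_iff)
  moreover have "continuous_on UNIV (\<lambda>x. complex_of_real ((bump c e x)\<^sup>2))"
    by (intro continuous_intros continuous_on_bump e)
  with dos compact_closure_bump_square[OF e, of c]
  have "(LINT x|N. complex_of_real ((bump c e x)\<^sup>2))
      = (1 / measure M F) *\<^sub>R (LINT \<omega>:F|M. bump_density c e \<omega>)"
    unfolding is_density_of_states_def bump_density_def by blast
  ultimately show ?thesis
    using integral_bump_square_eq_0_iff[of N e c] dos e
    by (simp add: is_density_of_states_def del: of_real_power integral_complex_of_real)
qed

end

theorem theorem5p1:
  fixes M :: "'a measure" and T :: "'a \<Rightarrow> 'a" and f :: "'a \<Rightarrow> real"
    and Sigma :: "real set" and dk :: "'a set \<Rightarrow> real measure"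
  assumes "sigma_finite_measure M" and "emeasure M (space M) = \<infinity>"
    and "invertible_transformation M T" and "measure_preserving M T"
    and "ergodic M T" and "conservative M T"
    and "f \<in> borel_measurable M" and "\<exists>C. \<forall>\<omega>\<in>space M. \<bar>f \<omega>\<bar> \<le> C"
    and "compact Sigma"
    and "AE \<omega> in M. spectrum (ham M T f \<omega>) = complex_of_real ` Sigma"
    and "\<And>F. F \<in> finite_positive_sets M \<Longrightarrow> is_density_of_states M T f F (dk F)"
  shows "closure (\<Union>F\<in>finite_positive_sets M. topological_support (dk F)) = Sigma"
proof -
  obtain C where "\<And>\<omega>. \<omega> \<in> space M \<Longrightarrow> \<bar>f \<omega>\<bar> \<le> C"
    using assms(8) by blast
  then interpret dynamical_schrodinger M T f C
    using assms by unfold_locales auto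
  note dos = assms(11)
  show ?thesis
  proof
    have "topological_support (dk F) \<subseteq> Sigma" if F: "F \<in> finite_positive_sets M" for F
    proof (rule ccontr)
      assume "\<not> topological_support (dk F) \<subseteq> Sigma"
      then obtain x where x: "x \<in> topological_support (dk F)" "x \<in> - Sigma"
        by blast
      moreover have "open (- Sigma)"
        using assms(9) by (simp add: compact_imp_closed open_Compl)
      ultimately obtain e where e: "0 < e" "ball x e \<subseteq> - Sigma"
        by (meson openE)
      \<comment> \<open>The ball misses \<open>Sigma\<close>, so the squared bump is zero on almost
        every spectrum.\<close>
      have "AE \<omega> in M. bump_density x e \<omega> = 0"
        using assms(10) AE_space
      proof eventually_elim
        case (elim \<omega>)
        have "cont_calculus (\<lambda>y. of_real ((bump x e y)\<^sup>2)) (H \<omega>) (delta 0) = 0"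
          by (rule cont_calculus_eq_0[OF self_adjoint_ham[OF elim(2)]])
            (use e elim(1) in \<open>auto simp: bump_eq_0_iff\<close>)
        then show ?case
          by (simp add: bump_density_def cinner_delta_left)
      qed
      then have "(LINT \<omega>:F|M. bump_density x e \<omega>) = 0"
        unfolding set_lebesgue_integral_def by (intro integral_eq_zero_AE) (auto elim: eventually_mono)
      then have "emeasure (dk F) (ball x e) = 0"
        by (simp add: density_of_states_ball_eq_0_iff[OF F dos[OF F] e(1)])
      with x(1) e(1) show False
        by (auto simp: topological_support_def dest!: spec[of _ "ball x e"])
    qed
    then show "closure (\<Union>F\<in>finite_positive_sets M. topological_support (dk F)) \<subseteq> Sigma"
      using assms(9) by (intro closure_minimal UN_least compact_imp_closed) auto
    show "Sigma \<subseteq> closure (\<Union>F\<in>finite_positive_sets M. topological_support (dk F))" (is "_ \<subseteq> closure ?S")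
    proof (rule ccontr)
      assume "\<not> Sigma \<subseteq> closure ?S"
      then obtain E where E: "E \<in> Sigma" "E \<in> - closure ?S"
        by blast
      then obtain e where e: "0 < e" "ball E e \<subseteq> - closure ?S"
        by (meson open_Compl closed_closure openE)
      have int0: "(LINT \<omega>:F|M. bump_density E e \<omega>) = 0"
        if F: "F \<in> finite_positive_sets M" for F
      proof -
        have "ball E e \<inter> topological_support (dk F) = {}"
          using e(2) F closure_subset[of ?S] by blast
        then have "emeasure (dk F) (ball E e) = 0"
          using dos[OF F] by (intro emeasure_eq_0_if_disjoint_topological_support)
            (auto simp: is_density_of_states_def)
        then show ?thesis
          by (simp add: density_of_states_ball_eq_0_iff[OF F dos[OF F] e(1)])
      qed
      obtain P :: "nat \<Rightarrow> complex poly" where P: "\<And>k. map_poly cnj (P k) = P k"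
        "uniform_limit {- (2 + C)..2 + C} (\<lambda>k x. poly (P k) (of_real x)) (\<lambda>x. of_real (bump E e x)) sequentially"
        "\<And>k x. x \<in> {- (2 + C)..2 + C} \<Longrightarrow> norm (poly (P k) (of_real x)) \<le> 2"
        using bump_approximation[OF e(1), of E] by blast
      have "AE \<omega> in M. complex_of_real E \<notin> spectrum (H \<omega>)"
        by (rule AE_bump_center_not_in_spectrum[OF e(1) P assms(1) int0])
      with assms(10) have "AE \<omega> in M. False"
      proof eventually_elim
        case (elim \<omega>)
        then show ?case
          using E(1) by auto
      qed
      \<comment> \<open>This would make the whole space null, although its measure is
        infinite.\<close>
      then have "ae_filter M = bot"
        by (simp add: trivial_limit_def)
      then show False
        using assms(2) by (simp add: ae_filter_eq_bot_iff)
    qed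
  qed
qed

end
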